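(* Let $\eta=10^{-3}$ and, for $s\geq 0$, let \[ u(s)=\frac{1}{2\eta}\Bigl(\chi_{(1-\eta,1+\eta)}(s)+3\chi_{(5/3-\eta,5/3+\eta)}(s)+\chi_{(6-\eta,6+\eta)}(s)\Bigr). \] Define $F:\mathbb{R}^3\to[0,\infty)$ by $F(0)=0$ and $F(y)=u(\|y\|)/\|y\|$ for $y\neq 0$, and define \[ h=\frac12\chi_{B_{\eta/2}}-\frac1{14}\chi_{B_\eta\setminus B_{\eta/2}},\qquad B_t=B(0,t)\subset\mathbb{R}^3. \] For every $0<\epsilon\leq 10^{-6}$, the functions \[ f(y)=F(y)+\epsilon\bigl(e^{-\|y\|}+h(y)\bigr),\qquad g(y)=F(y)+\epsilon\bigl(e^{-\|y\|}-h(y)\bigr) \] are bounded, radial, strictly positive functions in $L^1(\mathbb{R}^3)$ such that \[ M_cf(x)=M_cg(x)\quad\text{for every }x\in\mathbb{R}^3,\qquad \|f-g\|_1=\frac{\epsilon\pi\eta^3}{3}>0. \] Their common $L^1$ norm is $48\pi+8\pi\epsilon$.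
   Context: $B(x,r)=\{y\in\mathbb{R}^3:\|x-y\|<r\}$ is the open Euclidean ball and $|E|$ is Lebesgue measure. For $f\in L^1_{\mathrm{loc}}(\mathbb{R}^3)$, the central Hardy--Littlewood maximal function is $M_cf(x)=\sup_{r>0}\frac{1}{|B(x,r)|}\int_{B(x,r)}|f(t)|\,dt$. $\chi_A$ denotes the characteristic function of $A$. *)

theory Defs
  imports "HOL-Analysis.Analysis"
begin

text \<open>
  The maximal function takes values in \<open>[0,\<infinity>]\<close>, so that no finiteness convention is
  needed for the supremum.
\<close>
definition Mc :: "(real^3 \<Rightarrow> real) \<Rightarrow> real^3 \<Rightarrow> ennreal" where
  "Mc f x = (SUP r\<in>{0<..}.
     (\<integral>\<^sup>+t\<in>ball x r. ennreal \<bar>f t\<bar> \<partial>lebesgue) / emeasure lebesgue (ball x r))"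

text \<open>
  A Bochner integral, hence 0 by convention if \<open>f\<close> is not integrable; it is to be used
  together with \<open>integrable lebesgue f\<close>.
\<close>
definition L1_norm :: "(real^3 \<Rightarrow> real) \<Rightarrow> real" where
  "L1_norm f = (\<integral>x. \<bar>f x\<bar> \<partial>lebesgue)"

definition radial :: "(real^3 \<Rightarrow> real) \<Rightarrow> bool" where
  "radial f \<longleftrightarrow> (\<forall>x y. norm x = norm y \<longrightarrow> f x = f y)"

definition eta :: real where
  "eta = 1 / 10 ^ 3"

definition u :: "real \<Rightarrow> real" where
  "u s = 1 / (2 * eta) *
     (indicator {1 - eta <..< 1 + eta} s
      + 3 * indicator {5/3 - eta <..< 5/3 + eta} s
      + indicator {6 - eta <..< 6 + eta} s)"

definition F :: "real^3 \<Rightarrow> real" where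
  "F y = (if y = 0 then 0 else u (norm y) / norm y)"

definition h :: "real^3 \<Rightarrow> real" where
  "h y = 1/2 * indicator (ball 0 (eta/2)) y
         - 1/14 * indicator (ball 0 eta - ball 0 (eta/2)) y"

lemma F_nonneg: "F y \<ge> 0"
  by (simp add: F_def u_def eta_def)

end

theory Submission
  imports Defs "HOL-Real_Asymp.Real_Asymp"
begin

text \<open>
  The function \<open>h\<close> has mean zero and vanishes outside the core \<open>ball 0 eta\<close>. Hence \<open>f\<close> and \<open>g\<close>
  have the same average over \<open>ball x r\<close> whenever this ball contains the core or misses it, that is,
  whenever \<open>\<bar>r - norm x\<bar> \<ge> eta\<close> (\<open>nn_integral_perturbed_ball_eq\<close>). The maximal functions can
  therefore differ at \<open>x\<close> only through radii \<open>r\<close> within \<open>eta\<close> of \<open>\<rho> = norm x\<close>. The function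
  \<open>F\<close> is designed to make such radii irrelevant: for each of them there is a competing radius \<open>r'\<close>
  such that the average of \<open>F\<close> alone over \<open>ball x r'\<close> exceeds its average over \<open>ball x r\<close> by more
  than the perturbation of size \<open>\<epsilon>\<close> can contribute. Since \<open>F \<le> f\<close> and \<open>F \<le> g\<close>, either
  maximal function dominates all averages of the other one.

  The averages of \<open>F\<close> can be computed. By Archimedes' hat-box theorem (\<open>nn_integral_norm_inner\<close>),
  the part of the sphere \<open>norm y = s\<close> inside \<open>ball x r\<close> has area
  \<open>(\<pi> s / \<rho>) (r\<^sup>2 - (s - \<rho>)\<^sup>2)\<close>, truncated to the interval from \<open>0\<close> to \<open>4 \<pi> s\<^sup>2\<close>. The weight
  \<open>1 / norm y\<close> in \<open>F\<close> cancels the factor \<open>s\<close>, so that \<open>F\<close> has mass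
  \<open>(\<pi> / \<rho>) \<integral> u(s) K(s) ds\<close> in \<open>ball x r\<close>, where \<open>K\<close> is the truncation of
  \<open>r\<^sup>2 - (s - \<rho>)\<^sup>2\<close> (\<open>nn_integral_F_ball\<close>). The shells are so thin that \<open>u\<close> may be treated as
  point masses \<open>1\<close>, \<open>3\<close>, \<open>1\<close> at \<open>1\<close>, \<open>5/3\<close>, \<open>6\<close>, and finding \<open>r'\<close> becomes a comparison of
  \<open>(\<Sum>i. w\<^sub>i K(s\<^sub>i)) / r\<^sup>3\<close> at two radii: a polynomial inequality in \<open>\<rho>\<close>.

  Which \<open>r'\<close> works depends on \<open>\<rho>\<close>. If \<open>\<rho> < 1/2\<close>, a ball with \<open>r \<approx> \<rho>\<close> meets no shell, and the
  ball of radius \<open>3/2\<close>, which contains the first shell, wins. Up to \<open>\<rho> = 0.87\<close> one takes \<open>r' \<approx> \<rho> + 1\<close>, which swallows the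
  first shell whole; then a small ball cutting the first shell, and up to \<open>\<rho> = 3\<close> some \<open>r' < \<rho>\<close> for
  which the mass of the first two shells suffices. For \<open>3 \<le> \<rho> \<le> 5.1\<close> none of these choices works
  throughout. There \<open>r \<approx> \<rho>\<close> meets all three
  shells, the average is proportional to \<open>(5 r\<^sup>2 - B) / r\<^sup>3\<close> with \<open>3 B > 5 r\<^sup>2\<close>, and so it is still
  increasing in \<open>r\<close>: a slightly larger radius is better. This is the tight case; the relative
  gain is only a few thousandths. Beyond \<open>5.1\<close>, again \<open>r' \<approx> \<rho> + 1\<close> works: as \<open>\<rho> \<rightarrow> \<infinity>\<close> the
  masses compare like \<open>17\<close> to \<open>12\<close>.
\<close>

section \<open>The hat-box theorem\<close>

text \<open>
  Half-lines bounded above are the right generators for distributions of a radius, whose total mass is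
  infinite while balls have finite measure.
\<close>
lemma real_measure_eqI_atMost:
  fixes M N :: "real measure"
  assumes sets: "sets M = sets borel" "sets N = sets borel"
    and eq: "\<And>a. emeasure M {..a} = emeasure N {..a}"
    and fin: "\<And>a. emeasure M {..a} \<noteq> \<infinity>"
  shows "M = N"
proof (rule measure_eqI_generator_eq)
  let ?E = "range (\<lambda>a::real. {..a})"
  show "Int_stable ?E"
    by (auto simp: Int_stable_def)
  show "?E \<subseteq> Pow UNIV" by simp
  show "sets M = sigma_sets UNIV ?E" "sets N = sigma_sets UNIV ?E"
    using sets by (simp_all add: borel_eq_atMost)
  show "range (\<lambda>n::nat. {..real n}) \<subseteq> ?E" by auto
  show "(\<Union>n::nat. {..real n}) = UNIV"
    by (auto intro: real_arch_simple)
  show "emeasure M {..real n} \<noteq> \<infinity>" for n by (rule fin)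
  show "emeasure M X = emeasure N X" if "X \<in> ?E" for X
    using that eq by auto
qed

lemma nn_integral_linear_density:
  fixes a b :: real
  assumes "0 \<le> a" "a \<le> b"
  shows "(\<integral>\<^sup>+s. ennreal (2 * pi * s) * indicator {a..b} s \<partial>lborel) = ennreal (pi * (b\<^sup>2 - a\<^sup>2))"
proof -
  have "(\<integral>\<^sup>+s. ennreal (2 * pi * s) * indicator {a..b} s \<partial>lborel) = ennreal (pi * b\<^sup>2 - pi * a\<^sup>2)"
    by (rule nn_integral_FTC_Icc) (use assms in \<open>auto intro!: derivative_eq_intros\<close>)
  then show ?thesis by (simp add: algebra_simps)
qed

text \<open>
  The points of the plane at height \<open>z\<close> with distance at most \<open>a\<close> from the origin of space form a disc
  of area \<open>\<pi> (a\<^sup>2 - z\<^sup>2)\<close>. Its derivative \<open>2 \<pi> a\<close> does not depend on \<open>z\<close>, which is the reason for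
  the hat-box theorem.
\<close>
lemma distr_plane_hypotenuse:
  fixes z :: real
  shows "distr lborel borel (\<lambda>p::real\<times>real. sqrt (z\<^sup>2 + (norm p)\<^sup>2))
    = density lborel (\<lambda>s. ennreal (2 * pi * s) * indicator {\<bar>z\<bar>..} s)" (is "?M = ?N")
proof (rule real_measure_eqI_atMost)
  show "sets ?M = sets borel" "sets ?N = sets borel" by simp_all
  have M: "emeasure ?M {..a} = ennreal (if \<bar>z\<bar> \<le> a then pi * (a\<^sup>2 - z\<^sup>2) else 0)" for a
  proof -
    have *: "(sqrt (z\<^sup>2 + (norm p)\<^sup>2) \<le> a) \<longleftrightarrow> \<bar>z\<bar> \<le> a \<and> norm p \<le> sqrt (a\<^sup>2 - z\<^sup>2)" for p :: "real \<times> real"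
    proof (cases "\<bar>z\<bar> \<le> a")
      case True
      have "(sqrt (z\<^sup>2 + (norm p)\<^sup>2) \<le> a) \<longleftrightarrow> z\<^sup>2 + (norm p)\<^sup>2 \<le> a\<^sup>2"
        using True by (metis abs_ge_zero abs_of_nonneg order.trans real_sqrt_abs real_sqrt_le_iff)
      also have "\<dots> \<longleftrightarrow> norm p \<le> sqrt (a\<^sup>2 - z\<^sup>2)"
        using real_le_rsqrt[of "norm p" "a\<^sup>2 - z\<^sup>2"] real_le_lsqrt
        by (metis le_diff_eq add.commute norm_ge_zero real_sqrt_abs real_sqrt_le_iff abs_of_nonneg)
      finally show ?thesis using True by simp
    next
      case False
      have "\<bar>z\<bar> \<le> sqrt (z\<^sup>2 + (norm p)\<^sup>2)" 
        by (rule real_le_rsqrt) simp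
      with False show ?thesis by linarith
    qed
    have "emeasure ?M {..a} = emeasure lborel {p::real\<times>real. sqrt (z\<^sup>2 + (norm p)\<^sup>2) \<le> a}"
      by (subst emeasure_distr) (auto simp: vimage_def)
    also have "\<dots> = emeasure lborel (if \<bar>z\<bar> \<le> a then cball (0::real\<times>real) (sqrt (a\<^sup>2 - z\<^sup>2)) else {})"
      unfolding * by (rule arg_cong[where f="emeasure lborel"]) (simp add: set_eq_iff)
    also have "\<dots> = ennreal (if \<bar>z\<bar> \<le> a then pi * (a\<^sup>2 - z\<^sup>2) else 0)"
      by (auto simp: emeasure_cball unit_ball_vol_2 abs_le_square_iff power2_le_iff_abs_le)
    finally show ?thesis .
  qed
  have N: "emeasure ?N {..a} = ennreal (if \<bar>z\<bar> \<le> a then pi * (a\<^sup>2 - z\<^sup>2) else 0)" for a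
  proof -
    have "emeasure ?N {..a} = (\<integral>\<^sup>+s. ennreal (2 * pi * s) * indicator {\<bar>z\<bar>..a} s \<partial>lborel)"
      by (subst emeasure_density) (auto intro!: nn_integral_cong split: split_indicator)
    also have "\<dots> = ennreal (if \<bar>z\<bar> \<le> a then pi * (a\<^sup>2 - z\<^sup>2) else 0)"
      by (auto simp: nn_integral_linear_density)
    finally show ?thesis .
  qed
  show "emeasure ?M {..a} = emeasure ?N {..a}" for a unfolding M N ..
  show "emeasure ?M {..a} \<noteq> \<infinity>" for a unfolding M by simp
qed

lemma emeasure_lborel_Times:
  fixes A :: "'a::euclidean_space set" and B :: "'b::euclidean_space set"
  assumes "A \<in> sets borel" "B \<in> sets borel"
  shows "emeasure lborel (A \<times> B) = emeasure lborel A * emeasure lborel B"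
  unfolding lborel_prod[symmetric]
  using assms by (subst lborel.emeasure_pair_measure_Times) simp_all

text \<open>
  Space as a line times a plane, so that Fubini's theorem applies to horizontal slices.
\<close>
definition real3_of_triple :: "real \<times> real \<times> real \<Rightarrow> real^3" where
  "real3_of_triple = (\<lambda>(a, b, c). vector [a, b, c])"

lemma real3_of_triple_measurable [measurable]: "real3_of_triple \<in> borel_measurable borel"
proof -
  have "continuous_on UNIV (\<lambda>x. real3_of_triple x $ i)" for i
    using exhaust_3[of i]
    by (elim disjE; simp add: real3_of_triple_def case_prod_unfold; intro continuous_intros)
  then have "continuous_on UNIV real3_of_triple"
    by (subst continuous_on_componentwise) (auto simp: Basis_vec_def inner_axis)
  then show ?thesis by (rule borel_measurable_continuous_onI)
qed

lemma distr_real3_of_triple: "distr lborel borel real3_of_triple = lborel"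
proof (rule sym, rule lborel_eqI)
  fix l u :: "real^3"
  assume le: "\<And>b. b \<in> Basis \<Longrightarrow> l \<bullet> b \<le> u \<bullet> b"
  have le': "l $ i \<le> u $ i" for i
    using le[of "axis i 1"] by (simp add: inner_axis axis_in_Basis_iff)
  have "real3_of_triple -` box l u = box (l$1) (u$1) \<times> box (l$2) (u$2) \<times> box (l$3) (u$3)"
    by (auto simp: real3_of_triple_def mem_box_cart forall_3)
  then have "emeasure (distr lborel borel real3_of_triple) (box l u)
     = emeasure lborel (box (l$1) (u$1) \<times> (box (l$2) (u$2) \<times> box (l$3) (u$3)))"
    by (subst emeasure_distr) auto
  also have "\<dots> = ennreal ((u$1-l$1) * ((u$2-l$2) * (u$3-l$3)))"
    by (simp add: emeasure_lborel_Times borel_Times le' ennreal_mult'')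
  also have "\<dots> = (\<Prod>b\<in>Basis. (u - l) \<bullet> b)"
  proof -
    have B: "(Basis :: (real^3) set) = (\<lambda>i. axis i 1) ` UNIV"
      by (auto simp: Basis_vec_def)
    have "inj (\<lambda>i::3. axis i (1::real))"
      by (simp add: inj_on_def axis_eq_axis)
    then have "(\<Prod>b\<in>Basis. (u - l) \<bullet> b) = (\<Prod>i\<in>UNIV. (u - l) \<bullet> axis i 1)"
      unfolding B by (rule prod.reindex_cong) simp_all
    also have "\<dots> = (u$1-l$1) * ((u$2-l$2) * (u$3-l$3))"
      unfolding inner_axis UNIV_3 by simp
    finally show ?thesis by simp
  qed
  finally show "emeasure (distr lborel borel real3_of_triple) (box l u) = (\<Prod>b\<in>Basis. (u - l) \<bullet> b)" .
qed simp

text \<open>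
  Allows a given unit vector to be taken as the first coordinate axis.
\<close>
lemma distr_orthogonal:
  fixes f :: "(real, 'n::{finite,wellorder}) vec \<Rightarrow> (real, 'n) vec"
  assumes f: "orthogonal_transformation f"
  shows "distr lborel borel f = lborel"
proof (rule sym, rule lborel_eqI)
  fix l u :: "(real, 'n) vec"
  assume le: "\<And>b. b \<in> Basis \<Longrightarrow> l \<bullet> b \<le> u \<bullet> b"
  have lin: "linear f" by (rule orthogonal_transformation_linear[OF f])
  have meas: "f \<in> borel_measurable borel"
    by (intro borel_measurable_continuous_onI linear_continuous_on linear_conv_bounded_linear[THEN iffD1] lin)
  have inv: "orthogonal_transformation (inv f)"
    by (rule orthogonal_transformation_inv[OF f])
  have vimage: "f -` box l u = inv f ` box l u"
    by (rule bij_vimage_eq_inv_image[OF orthogonal_transformation_bij[OF f]])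
  have borel: "inv f ` box l u \<in> sets borel"
    using measurable_sets[OF meas, of "box l u"] by (simp add: vimage)
  have lmeas: "inv f ` box l u \<in> lmeasurable"
    by (rule measurable_orthogonal_image[OF inv]) simp
  have "emeasure (distr lborel borel f) (box l u) = emeasure lborel (inv f ` box l u)"
    using meas by (subst emeasure_distr) (simp_all add: vimage)
  also have "\<dots> = emeasure lebesgue (inv f ` box l u)"
    using borel by simp
  also have "\<dots> = ennreal (measure lebesgue (inv f ` box l u))"
    by (rule emeasure_eq_measure2[OF lmeas])
  also have "\<dots> = ennreal (measure lebesgue (box l u))"
    by (subst measure_orthogonal_image[OF inv]) simp_all
  also have "\<dots> = emeasure lborel (box l u)" 
    by (simp add: emeasure_lborel_box_eq measure_lborel_box_eq)
  also have "\<dots> = (\<Prod>b\<in>Basis. (u - l) \<bullet> b)"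
    using le by (simp add: emeasure_lborel_box)
  finally show "emeasure (distr lborel borel f) (box l u) = (\<Prod>b\<in>Basis. (u - l) \<bullet> b)" .
qed simp

lemma nn_integral_plane_hypotenuse:
  assumes [measurable]: "g \<in> borel_measurable borel"
  shows "(\<integral>\<^sup>+p. g (sqrt (z\<^sup>2 + (norm (p :: real \<times> real))\<^sup>2)) \<partial>lborel)
     = (\<integral>\<^sup>+s. ennreal (2 * pi * s) * indicator {\<bar>z\<bar>..} s * g s \<partial>lborel)"
proof -
  have "(\<integral>\<^sup>+p. g (sqrt (z\<^sup>2 + (norm (p :: real \<times> real))\<^sup>2)) \<partial>lborel)
     = (\<integral>\<^sup>+s. g s \<partial>distr lborel borel (\<lambda>p::real\<times>real. sqrt (z\<^sup>2 + (norm p)\<^sup>2)))"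
    by (subst nn_integral_distr) simp_all
  then show ?thesis
    unfolding distr_plane_hypotenuse by (subst (asm) nn_integral_density) simp_all
qed

text \<open>
  Archimedes' hat-box theorem in integrated form: on the sphere of radius \<open>s\<close>, the height
  \<open>y \<bullet> e\<close> is distributed with constant density \<open>2 \<pi> s\<close> over \<open>[-s, s]\<close>. After slicing
  orthogonally to \<open>e\<close>, the slice at height \<open>z\<close> contributes \<open>2 \<pi> s ds\<close> for \<open>s \<ge> \<bar>z\<bar>\<close>, and the order
  of integration is exchanged.
\<close>
theorem nn_integral_norm_inner:
  fixes e :: "real^3" and \<phi> :: "real \<times> real \<Rightarrow> ennreal"
  assumes e: "norm e = 1" and [measurable]: "\<phi> \<in> borel_measurable (borel \<Otimes>\<^sub>M borel)"
  shows "(\<integral>\<^sup>+y. \<phi> (norm y, y \<bullet> e) \<partial>lborel)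
    = (\<integral>\<^sup>+s. ennreal (2 * pi * s) * (\<integral>\<^sup>+z. indicator {-s..s} z * \<phi> (s, z) \<partial>lborel) \<partial>lborel)"
proof -
  have "norm (axis 1 1 :: real^3) = norm e" using e by simp
  then obtain f :: "real^3 \<Rightarrow> real^3" where f: "orthogonal_transformation f" and fe: "f (axis 1 1) = e"
    by (rule orthogonal_transformation_exists) blast
  have fm [measurable]: "f \<in> borel_measurable borel"
    by (intro borel_measurable_continuous_onI linear_continuous_on linear_conv_bounded_linear[THEN iffD1] 
       orthogonal_transformation_linear[OF f])
  have inner: "f y \<bullet> e = y $ 1" for y
  proof -
    have "f y \<bullet> e = y \<bullet> axis 1 1"
      unfolding fe[symmetric] using f by (simp add: orthogonal_transformation_def)
    then show ?thesis by (simp add: inner_axis)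
  qed
  have nR: "norm (real3_of_triple (z, p)) = sqrt (z\<^sup>2 + (norm p)\<^sup>2)" for z p
    by (cases p) (simp add: real3_of_triple_def norm_vec_def L2_set_def sum_3 norm_Pair add.assoc)
  \<comment> \<open>Rotate \<open>e\<close> to the first axis, then split off the first coordinate.\<close>
  have "(\<integral>\<^sup>+y. \<phi> (norm y, y \<bullet> e) \<partial>lborel) = (\<integral>\<^sup>+y. \<phi> (norm y, y \<bullet> e) \<partial>distr lborel borel f)"
    unfolding distr_orthogonal[OF f] ..
  also have "\<dots> = (\<integral>\<^sup>+y. \<phi> (norm (f y), f y \<bullet> e) \<partial>lborel)"
    by (subst nn_integral_distr) simp_all
  also have "\<dots> = (\<integral>\<^sup>+y. \<phi> (norm y, y $ 1) \<partial>distr lborel borel real3_of_triple)"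
    by (simp add: inner orthogonal_transformation_norm[OF f] distr_real3_of_triple)
  also have "\<dots> = (\<integral>\<^sup>+w. \<phi> (norm (real3_of_triple w), real3_of_triple w $ 1) \<partial>lborel)"
    by (subst nn_integral_distr) simp_all
  also have "\<dots> = (\<integral>\<^sup>+w. \<phi> (sqrt ((fst w)\<^sup>2 + (norm (snd w :: real \<times> real))\<^sup>2), fst w) \<partial>(lborel \<Otimes>\<^sub>M lborel))"
    unfolding lborel_prod
    by (intro nn_integral_cong) (auto simp: nR, simp add: real3_of_triple_def)
  also have "\<dots> = (\<integral>\<^sup>+z. \<integral>\<^sup>+p. \<phi> (sqrt (z\<^sup>2 + (norm (p :: real \<times> real))\<^sup>2), z) \<partial>lborel \<partial>lborel)"
    by (subst lborel.nn_integral_fst[symmetric]) simp_all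
  also have "\<dots> = (\<integral>\<^sup>+z. \<integral>\<^sup>+s. ennreal (2 * pi * s) * indicator {\<bar>z\<bar>..} s * \<phi> (s, z) \<partial>lborel \<partial>lborel)"
    by (intro nn_integral_cong nn_integral_plane_hypotenuse) simp
  also have "\<dots> = (\<integral>\<^sup>+z. \<integral>\<^sup>+s. ennreal (2 * pi * s) * (indicator {-s..s} z * \<phi> (s, z)) \<partial>lborel \<partial>lborel)"
    by (intro nn_integral_cong) (auto split: split_indicator)
  also have "\<dots> = (\<integral>\<^sup>+s. \<integral>\<^sup>+z. ennreal (2 * pi * s) * (indicator {-s..s} z * \<phi> (s, z)) \<partial>lborel \<partial>lborel)"
    by (rule lborel_pair.Fubini'[symmetric]) (simp add: indicator_def)
  also have "\<dots> = (\<integral>\<^sup>+s. ennreal (2 * pi * s) * (\<integral>\<^sup>+z. indicator {-s..s} z * \<phi> (s, z) \<partial>lborel) \<partial>lborel)"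
    by (intro nn_integral_cong nn_integral_cmult) simp
  finally show ?thesis .
qed

section \<open>The mass of \<open>F\<close> in a ball\<close>

text \<open>
  For \<open>\<rho> = norm x\<close>, the part of the sphere \<open>norm y = s\<close> that lies in \<open>ball x r\<close> has area
  \<open>(\<pi> s / \<rho>) * lens_profile \<rho> r s\<close>. The truncations say that the sphere misses the ball or lies
  in it.
\<close>
definition lens_profile :: "real \<Rightarrow> real \<Rightarrow> real \<Rightarrow> real" where
  "lens_profile \<rho> r s = max 0 (min (4 * \<rho> * s) (r\<^sup>2 - (s - \<rho>)\<^sup>2))"

lemma lens_profile_measurable [measurable]: "lens_profile \<rho> r \<in> borel_measurable borel"
  unfolding lens_profile_def by measurable

lemma nn_integral_radial:
  assumes [measurable]: "g \<in> borel_measurable borel"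
  shows "(\<integral>\<^sup>+y. g (norm (y :: real^3)) \<partial>lborel)
    = (\<integral>\<^sup>+s. ennreal (4 * pi * s\<^sup>2) * indicator {0..} s * g s \<partial>lborel)"
proof -
  have "(\<integral>\<^sup>+y. g (norm (y :: real^3)) \<partial>lborel)
     = (\<integral>\<^sup>+s. ennreal (2 * pi * s) * (\<integral>\<^sup>+z. indicator {-s..s} z * g s \<partial>lborel) \<partial>lborel)"
    by (subst nn_integral_norm_inner[of "axis 1 1" "\<lambda>p. g (fst p)", simplified]) simp_all
  also have "\<dots> = (\<integral>\<^sup>+s. ennreal (4 * pi * s\<^sup>2) * indicator {0..} s * g s \<partial>lborel)"
  proof (intro nn_integral_cong)
    fix s :: real
    have *: "(\<integral>\<^sup>+z. indicator {-s..s} z * g s \<partial>lborel) = emeasure lborel {-s..s} * g s"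
      by (subst nn_integral_multc) simp_all
    show "ennreal (2 * pi * s) * (\<integral>\<^sup>+z. indicator {-s..s} z * g s \<partial>lborel)
       = ennreal (4 * pi * s\<^sup>2) * indicator {0..} s * g s"
    proof (cases "s \<ge> 0")
      case True
      then have "ennreal (2 * pi * s) * ennreal (s - (- s)) = ennreal (4 * pi * s\<^sup>2)"
        by (subst ennreal_mult[symmetric]) (simp_all add: power2_eq_square)
      with True show ?thesis unfolding * by (simp add: mult.assoc[symmetric])
    next
      case False
      then show ?thesis unfolding * by (simp add: ennreal_neg mult_nonneg_nonpos)
    qed
  qed
  finally show ?thesis .
qed

text \<open>
  In terms of \<open>s = norm y\<close> and the height \<open>z\<close> of \<open>y\<close> in direction \<open>x\<close>, membership in \<open>ball x r\<close> is
  the condition \<open>z > (s\<^sup>2 + \<rho>\<^sup>2 - r\<^sup>2) / (2 \<rho>)\<close>, so the sphere of radius \<open>s\<close> meets the ball in a cap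
  and the hat-box theorem gives its area.
\<close>
lemma nn_integral_radial_ball:
  fixes x :: "real^3"
  assumes [measurable]: "g \<in> borel_measurable borel" and x: "x \<noteq> 0" and r: "r > 0"
  shows "(\<integral>\<^sup>+y\<in>ball x r. g (norm y) \<partial>lborel)
    = (\<integral>\<^sup>+s. ennreal (pi * s / norm x) * ennreal (lens_profile (norm x) r s) * g s \<partial>lborel)"
proof -
  define \<rho> where "\<rho> = norm x"
  have \<rho>: "\<rho> > 0" using x by (simp add: \<rho>_def)
  define e where "e = x /\<^sub>R \<rho>"
  have e: "norm e = 1" using \<rho> by (simp add: e_def \<rho>_def)
  have xe: "x = \<rho> *\<^sub>R e" using \<rho> by (simp add: e_def)
  define c where "c s = (s\<^sup>2 + \<rho>\<^sup>2 - r\<^sup>2) / (2 * \<rho>)" for s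
  have [measurable]: "c \<in> borel_measurable borel" unfolding c_def by measurable
  have ball: "y \<in> ball x r \<longleftrightarrow> c (norm y) < y \<bullet> e" for y
  proof -
    have "y \<in> ball x r \<longleftrightarrow> (norm (x - y))\<^sup>2 < r\<^sup>2"
      using r by (simp add: dist_norm not_le[symmetric] abs_le_square_iff[symmetric])
    also have "(norm (x - y))\<^sup>2 = \<rho>\<^sup>2 + (norm y)\<^sup>2 - 2 * (\<rho> * (y \<bullet> e))"
    proof -
      have "(norm (x - y))\<^sup>2 = x \<bullet> x + y \<bullet> y - 2 * (x \<bullet> y)"
        by (simp add: power2_norm_eq_inner inner_diff inner_commute)
      moreover have "x \<bullet> y = \<rho> * (y \<bullet> e)"
        by (subst xe) (simp add: inner_commute)
      ultimately show ?thesis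
        by (simp add: \<rho>_def power2_norm_eq_inner)
    qed
    also have "\<dots> < r\<^sup>2 \<longleftrightarrow> c (norm y) < y \<bullet> e"
      using \<rho> by (simp add: c_def field_simps)
    finally show ?thesis .
  qed
  have "(\<integral>\<^sup>+y\<in>ball x r. g (norm y) \<partial>lborel)
     = (\<integral>\<^sup>+y. (\<lambda>p. g (fst p) * indicator {0<..} (snd p - c (fst p))) (norm y, y \<bullet> e) \<partial>lborel)"
    by (intro nn_integral_cong) (simp add: indicator_def ball[symmetric])
  also have "\<dots> = (\<integral>\<^sup>+s. ennreal (2 * pi * s) *
      (\<integral>\<^sup>+z. indicator {-s..s} z * (g s * indicator {0<..} (z - c s)) \<partial>lborel) \<partial>lborel)"
    by (subst nn_integral_norm_inner[OF e]) simp_all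
  also have "\<dots> = (\<integral>\<^sup>+s. ennreal (pi * s / \<rho>) * ennreal (lens_profile \<rho> r s) * g s \<partial>lborel)"
  proof (intro nn_integral_cong)
    fix s :: real
    show "ennreal (2 * pi * s) * (\<integral>\<^sup>+z. indicator {-s..s} z * (g s * indicator {0<..} (z - c s)) \<partial>lborel)
      = ennreal (pi * s / \<rho>) * ennreal (lens_profile \<rho> r s) * g s"
    proof (cases "s > 0")
      case True
      have "(\<integral>\<^sup>+z. indicator {-s..s} z * (g s * indicator {0<..} (z - c s)) \<partial>lborel)
        = (\<integral>\<^sup>+z. indicator ({-s..s} \<inter> {c s<..}) z * g s \<partial>lborel)"
        by (intro nn_integral_cong) (auto split: split_indicator)
      also have "\<dots> = emeasure lborel ({-s..s} \<inter> {c s<..}) * g s"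
        by (subst nn_integral_multc) simp_all
      also have "{-s..s} \<inter> {c s<..} = (if c s < -s then {-s..s} else {c s<..s})"
        by auto
      also have "emeasure lborel \<dots> = ennreal (lens_profile \<rho> r s / (2 * \<rho>))"
      proof -
        have 1: "r\<^sup>2 - (s - \<rho>)\<^sup>2 = 2 * \<rho> * (s - c s)"
          using \<rho> by (simp add: c_def field_simps power2_eq_square)
        have 2: "4 * \<rho> * s = 2 * \<rho> * (2 * s)" by simp
        have "lens_profile \<rho> r s / (2 * \<rho>) = max 0 (min (2 * s) (s - c s))"
          unfolding lens_profile_def 1 2 using \<rho>
          by (auto simp: max_def min_def zero_le_mult_iff mult_le_0_iff)
        then show ?thesis using True
          by (auto simp: max_def min_def ennreal_neg)
      qed
      finally have "ennreal (2 * pi * s) * (\<integral>\<^sup>+z. indicator {-s..s} z * (g s * indicator {0<..} (z - c s)) \<partial>lborel)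
        = ennreal (2 * pi * s) * ennreal (lens_profile \<rho> r s / (2 * \<rho>)) * g s"
        by (simp add: mult.assoc)
      also have "ennreal (2 * pi * s) * ennreal (lens_profile \<rho> r s / (2 * \<rho>))
        = ennreal (pi * s / \<rho>) * ennreal (lens_profile \<rho> r s)"
        using True \<rho> by (simp add: ennreal_mult[symmetric] lens_profile_def)
      finally show ?thesis .
    next
      case False
      then show ?thesis using \<rho> by (simp add: ennreal_neg mult_nonneg_nonpos divide_nonpos_pos)
    qed
  qed
  finally show ?thesis unfolding \<rho>_def .
qed

lemma F_eq: "F y = u (norm y) / norm y"
  by (simp add: F_def)

lemma u_nonneg: "0 \<le> u s"
  by (simp add: u_def eta_def)

lemma u_measurable [measurable]: "u \<in> borel_measurable borel"
  unfolding u_def by measurable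

lemma F_measurable [measurable]: "F \<in> borel_measurable borel"
  unfolding F_eq[abs_def] by measurable

text \<open>
  The density \<open>u\<close> with its three shells weighted separately, which expresses bounds on
  \<open>u s * k s\<close> that are constant on each shell.
\<close>
definition weighted_shells :: "real \<Rightarrow> real \<Rightarrow> real \<Rightarrow> real \<Rightarrow> real" where
  "weighted_shells a b c s = 1 / (2 * eta) *
     (a * indicator {1 - eta <..< 1 + eta} s
      + 3 * b * indicator {5/3 - eta <..< 5/3 + eta} s
      + c * indicator {6 - eta <..< 6 + eta} s)"

lemma u_eq_weighted_shells: "u s * k = weighted_shells k k k s"
  by (simp add: u_def weighted_shells_def algebra_simps)

lemma weighted_shells_mono:
  assumes "\<bar>s - 1\<bar> < eta \<Longrightarrow> a \<le> a'" "\<bar>s - 5/3\<bar> < eta \<Longrightarrow> b \<le> b'" "\<bar>s - 6\<bar> < eta \<Longrightarrow> c \<le> c'"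
  shows "weighted_shells a b c s \<le> weighted_shells a' b' c' s"
proof -
  have "a * indicator {1 - eta <..< 1 + eta} s \<le> a' * indicator {1 - eta <..< 1 + eta} s"
    "3 * b * indicator {5/3 - eta <..< 5/3 + eta} s \<le> 3 * b' * indicator {5/3 - eta <..< 5/3 + eta} s"
    "c * indicator {6 - eta <..< 6 + eta} s \<le> c' * indicator {6 - eta <..< 6 + eta} s"
    using assms by (auto simp: abs_less_iff split: split_indicator)
  moreover have "0 \<le> 1 / (2 * eta)" by (simp add: eta_def)
  ultimately show ?thesis
    unfolding weighted_shells_def by (intro mult_left_mono add_mono)
qed

lemma nn_integral_weighted_shells:
  assumes "0 \<le> a" "0 \<le> b" "0 \<le> c"
  shows "(\<integral>\<^sup>+s. ennreal (weighted_shells a b c s) \<partial>lborel) = ennreal (a + 3 * b + c)"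
proof -
  have 1: "ennreal (weighted_shells a b c s) = 
      ennreal (a / (2 * eta)) * indicator {1 - eta <..< 1 + eta} s
      + ennreal (3 * b / (2 * eta)) * indicator {5/3 - eta <..< 5/3 + eta} s
      + ennreal (c / (2 * eta)) * indicator {6 - eta <..< 6 + eta} s" for s
    using assms unfolding weighted_shells_def eta_def
    by (auto split: split_indicator)
  show ?thesis
    using assms unfolding 1
    by (simp add: nn_integral_add nn_integral_cmult eta_def
       ennreal_mult[symmetric] ennreal_plus[symmetric] del: ennreal_plus)
qed

text \<open>
  The denominator \<open>norm y\<close> of \<open>F\<close> cancels the factor \<open>s\<close> of the area of the cap.
\<close>
lemma nn_integral_F_ball:
  fixes x :: "real^3"
  assumes x: "x \<noteq> 0" and r: "r > 0"
  shows "(\<integral>\<^sup>+y\<in>ball x r. ennreal (F y) \<partial>lborel)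
    = ennreal (pi / norm x) * (\<integral>\<^sup>+s. ennreal (u s * lens_profile (norm x) r s) \<partial>lborel)"
proof -
  have u0: "u s = 0" if "s \<le> 0" for s
    using that by (simp add: u_def eta_def)
  have *: "ennreal (pi * s / norm x) * ennreal (lens_profile (norm x) r s) * ennreal (u s / s)
     = ennreal (pi / norm x) * ennreal (u s * lens_profile (norm x) r s)" for s
  proof (cases "s > 0")
    case True
    then show ?thesis
      using u_nonneg[of s]
      by (simp add: ennreal_mult[symmetric] lens_profile_def)
  next
    case False
    then show ?thesis by (simp add: u0)
  qed
  have "(\<integral>\<^sup>+y\<in>ball x r. ennreal (F y) \<partial>lborel)
    = (\<integral>\<^sup>+s. ennreal (pi * s / norm x) * ennreal (lens_profile (norm x) r s) * ennreal (u s / s) \<partial>lborel)"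
    unfolding F_eq using nn_integral_radial_ball[OF _ x r, of "\<lambda>s. ennreal (u s / s)"] by simp
  then show ?thesis unfolding * by (simp add: nn_integral_cmult)
qed

text \<open>
  Treating the thin shells as point masses: only the extreme values of the profile on each shell enter.
\<close>
lemma nn_integral_F_ball_le:
  fixes x :: "real^3"
  assumes x: "x \<noteq> 0" and r: "r > 0" and pos: "0 \<le> a" "0 \<le> b" "0 \<le> c"
    and "\<And>s. \<bar>s - 1\<bar> < eta \<Longrightarrow> lens_profile (norm x) r s \<le> a"
    and "\<And>s. \<bar>s - 5/3\<bar> < eta \<Longrightarrow> lens_profile (norm x) r s \<le> b"
    and "\<And>s. \<bar>s - 6\<bar> < eta \<Longrightarrow> lens_profile (norm x) r s \<le> c"
  shows "(\<integral>\<^sup>+y\<in>ball x r. ennreal (F y) \<partial>lborel) \<le> ennreal (pi / norm x * (a + 3 * b + c))"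
proof -
  have "(\<integral>\<^sup>+s. ennreal (u s * lens_profile (norm x) r s) \<partial>lborel)
     \<le> (\<integral>\<^sup>+s. ennreal (weighted_shells a b c s) \<partial>lborel)"
    unfolding u_eq_weighted_shells
    using assms(6-8) by (intro nn_integral_mono ennreal_leI weighted_shells_mono)
  moreover have "ennreal (pi / norm x * (a + 3 * b + c)) = ennreal (pi / norm x) * ennreal (a + 3 * b + c)"
    by (rule ennreal_mult) (use pos in auto)
  ultimately show ?thesis
    unfolding nn_integral_F_ball[OF x r] nn_integral_weighted_shells[OF pos]
    by (simp only: mult_left_mono zero_le)
qed

lemma nn_integral_F_ball_ge:
  fixes x :: "real^3"
  assumes x: "x \<noteq> 0" and r: "r > 0"
    and "\<And>s. \<bar>s - 1\<bar> < eta \<Longrightarrow> a \<le> lens_profile (norm x) r s"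
    and "\<And>s. \<bar>s - 5/3\<bar> < eta \<Longrightarrow> b \<le> lens_profile (norm x) r s"
    and "\<And>s. \<bar>s - 6\<bar> < eta \<Longrightarrow> c \<le> lens_profile (norm x) r s"
  shows "ennreal (pi / norm x * (a + 3 * b + c)) \<le> (\<integral>\<^sup>+y\<in>ball x r. ennreal (F y) \<partial>lborel)"
proof -
  define a' b' c' where "a' = max 0 a" and "b' = max 0 b" and "c' = max 0 c"
  have pos: "0 \<le> a'" "0 \<le> b'" "0 \<le> c'" by (simp_all add: a'_def b'_def c'_def)
  have K: "0 \<le> lens_profile (norm x) r s" for s by (simp add: lens_profile_def)
  have "\<bar>s - 1\<bar> < eta \<Longrightarrow> a' \<le> lens_profile (norm x) r s"
    "\<bar>s - 5/3\<bar> < eta \<Longrightarrow> b' \<le> lens_profile (norm x) r s"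
    "\<bar>s - 6\<bar> < eta \<Longrightarrow> c' \<le> lens_profile (norm x) r s" for s
    using assms(3-5)[of s] K[of s] by (auto simp: a'_def b'_def c'_def)
  then have "(\<integral>\<^sup>+s. ennreal (weighted_shells a' b' c' s) \<partial>lborel)
    \<le> (\<integral>\<^sup>+s. ennreal (u s * lens_profile (norm x) r s) \<partial>lborel)"
    unfolding u_eq_weighted_shells
    by (intro nn_integral_mono ennreal_leI weighted_shells_mono)
  moreover have "ennreal (pi / norm x * (a' + 3 * b' + c')) = ennreal (pi / norm x) * ennreal (a' + 3 * b' + c')"
    by (rule ennreal_mult) (use pos in auto)
  ultimately have "ennreal (pi / norm x * (a' + 3 * b' + c')) \<le> (\<integral>\<^sup>+y\<in>ball x r. ennreal (F y) \<partial>lborel)"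
    unfolding nn_integral_F_ball[OF x r] nn_integral_weighted_shells[OF pos]
    by (simp only: mult_left_mono zero_le)
  moreover have "pi / norm x * (a + 3 * b + c) \<le> pi / norm x * (a' + 3 * b' + c')"
    by (intro mult_left_mono) (auto simp: a'_def b'_def c'_def)
  ultimately show ?thesis by (meson ennreal_leI order_trans)
qed

section \<open>Integrals of the three constituents\<close>

text \<open>
  A shell of weight \<open>w\<close> at radius \<open>a\<close> has mass
  \<open>(w / (2 eta)) \<integral> 4 \<pi> s ds = 4 \<pi> w a\<close>, and \<open>1 + 3 * 5/3 + 6 = 12\<close>.
\<close>
lemma nn_integral_F: "(\<integral>\<^sup>+y. ennreal (F y) \<partial>lborel) = ennreal (48 * pi)"
proof -
  have shell: "(\<integral>\<^sup>+s. ennreal (4 * pi * s) * indicator {a - eta<..<a + eta} s \<partial>lborel) = ennreal (8 * pi * a * eta)"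
    if "a \<ge> 1" for a
  proof -
    have "(\<integral>\<^sup>+s. ennreal (4 * pi * s) * indicator {a - eta<..<a + eta} s \<partial>lborel)
      = (\<integral>\<^sup>+s. ennreal (4 * pi * s) * indicator {a - eta..a + eta} s \<partial>lborel)"
    proof (rule nn_integral_cong_AE)
      have "AE s in lborel. s \<noteq> a - eta \<and> s \<noteq> a + eta"
        by (intro AE_conjI AE_lborel_singleton)
      then show "AE s in lborel. ennreal (4 * pi * s) * indicator {a - eta<..<a + eta} s
          = ennreal (4 * pi * s) * indicator {a - eta..a + eta} s"
        by eventually_elim (auto simp: indicator_def)
    qed
    also have "\<dots> = ennreal (2 * pi * (a + eta)\<^sup>2 - 2 * pi * (a - eta)\<^sup>2)"
      using that by (intro nn_integral_FTC_Icc)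
        (auto simp: eta_def intro!: derivative_eq_intros)
    also have "2 * pi * (a + eta)\<^sup>2 - 2 * pi * (a - eta)\<^sup>2 = 8 * pi * a * eta"
      by (simp add: power2_eq_square algebra_simps)
    finally show ?thesis .
  qed
  have "(\<integral>\<^sup>+y. ennreal (F y) \<partial>lborel)
     = (\<integral>\<^sup>+s. ennreal (4 * pi * s\<^sup>2) * indicator {0..} s * ennreal (u s / s) \<partial>lborel)"
    unfolding F_eq using nn_integral_radial[of "\<lambda>s. ennreal (u s / s)"] by simp
  also have "\<dots> = (\<integral>\<^sup>+s. 
       500 * (ennreal (4 * pi * s) * indicator {1 - eta<..<1 + eta} s)
       + 1500 * (ennreal (4 * pi * s) * indicator {5/3 - eta<..<5/3 + eta} s)
       + 500 * (ennreal (4 * pi * s) * indicator {6 - eta<..<6 + eta} s) \<partial>lborel)"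
  proof (intro nn_integral_cong)
    fix s :: real
    have "ennreal (4 * pi * s\<^sup>2) * indicator {0..} s * ennreal (u s / s) = ennreal (4 * pi * s * u s)"
    proof (cases "s > 0")
      case True
      then show ?thesis
        by (simp add: ennreal_mult''[symmetric] u_nonneg power2_eq_square)
    next
      case False
      then have "u s = 0" by (simp add: u_def eta_def)
      then show ?thesis by simp
    qed
    also have "\<dots> = 
       500 * (ennreal (4 * pi * s) * indicator {1 - eta<..<1 + eta} s)
       + 1500 * (ennreal (4 * pi * s) * indicator {5/3 - eta<..<5/3 + eta} s)
       + 500 * (ennreal (4 * pi * s) * indicator {6 - eta<..<6 + eta} s)"
    proof -
      have "500 * ennreal t = ennreal (500 * t)" "1500 * ennreal t = ennreal (1500 * t)" if "t \<ge> 0" for t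
        using that by (simp_all add: ennreal_mult)
      then show ?thesis
        by (auto simp: u_def eta_def split: split_indicator)
    qed
    finally show "ennreal (4 * pi * s\<^sup>2) * indicator {0..} s * ennreal (u s / s) = 
       500 * (ennreal (4 * pi * s) * indicator {1 - eta<..<1 + eta} s)
       + 1500 * (ennreal (4 * pi * s) * indicator {5/3 - eta<..<5/3 + eta} s)
       + 500 * (ennreal (4 * pi * s) * indicator {6 - eta<..<6 + eta} s)" .
  qed
  also have "\<dots> = 500 * ennreal (8 * pi * 1 * eta) + 1500 * ennreal (8 * pi * (5/3) * eta) + 500 * ennreal (8 * pi * 6 * eta)"
    by (simp add: nn_integral_add nn_integral_cmult shell)
  also have "\<dots> = ennreal (48 * pi)"
  proof -
    have m: "500 * ennreal (8 * pi * t * eta) = ennreal (4 * pi * t)"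
      "1500 * ennreal (8 * pi * t * eta) = ennreal (12 * pi * t)" if "t \<ge> 0" for t
      using that ennreal_mult[of 500 "8 * pi * t * eta"] ennreal_mult[of 1500 "8 * pi * t * eta"]
      by (simp_all add: eta_def mult.assoc)
    show ?thesis
      by (simp only: m) (simp add: ennreal_plus[symmetric] del: ennreal_plus)
  qed
  finally show ?thesis .
qed

lemma nn_integral_exp_neg_norm:
  "(\<integral>\<^sup>+y. ennreal (exp (- norm (y::real^3))) \<partial>lborel) = ennreal (8 * pi)"
proof -
  define A where "A s = - (4 * pi) * ((s\<^sup>2 + 2 * s + 2) * exp (- s))" for s :: real
  have "(\<integral>\<^sup>+y. ennreal (exp (- norm (y::real^3))) \<partial>lborel)
    = (\<integral>\<^sup>+s. ennreal (4 * pi * s\<^sup>2) * indicator {0..} s * ennreal (exp (- s)) \<partial>lborel)"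
    using nn_integral_radial[of "\<lambda>s. ennreal (exp (- s))"] by simp
  also have "\<dots> = (\<integral>\<^sup>+s. ennreal (4 * pi * s\<^sup>2 * exp (- s)) * indicator {0..} s \<partial>lborel)"
    by (intro nn_integral_cong) (simp add: ennreal_mult mult_ac)
  also have "\<dots> = ennreal (0 - A 0)"
  proof (rule nn_integral_FTC_atLeast)
    show "DERIV A s :> 4 * pi * s\<^sup>2 * exp (- s)" for s
      unfolding A_def
      by (auto intro!: derivative_eq_intros simp: power2_eq_square algebra_simps)
    have "((\<lambda>s::real. (s\<^sup>2 + 2 * s + 2) * exp (- s)) \<longlongrightarrow> 0) at_top"
      by real_asymp
    then show "(A \<longlongrightarrow> 0) at_top"
      unfolding A_def by (rule tendsto_mult_right_zero)
  qed auto
  also have "0 - A 0 = 8 * pi" by (simp add: A_def)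
  finally show ?thesis .
qed

lemma emeasure_ball3: "r \<ge> 0 \<Longrightarrow> emeasure lborel (ball (c::real^3) r) = ennreal (4/3 * pi * r ^ 3)"
  by (simp add: emeasure_ball unit_ball_vol_3)

lemma measure_ball3: "r \<ge> 0 \<Longrightarrow> measure lborel (ball (c::real^3) r) = 4/3 * pi * r ^ 3"
  by (simp add: content_ball unit_ball_vol_3)

lemma h_bounds: "\<bar>h y\<bar> \<le> 1/2" "norm y \<ge> eta \<Longrightarrow> h y = 0"
  by (auto simp: h_def eta_def split: split_indicator)

text \<open>
  As a combination of indicators of balls, \<open>h\<close> can be integrated by reading off volumes.
\<close>
lemma h_eq: "h y = 4/7 * indicator (ball 0 (eta/2)) y - 1/14 * indicator (ball 0 eta) y"
  by (auto simp: h_def eta_def split: split_indicator)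

lemma h_measurable [measurable]: "h \<in> borel_measurable borel"
  unfolding h_eq[abs_def]
  by (intro borel_measurable_diff borel_measurable_times borel_measurable_const borel_measurable_indicator) simp_all

lemma abs_h_eq: "\<bar>h y\<bar> = 3/7 * indicator (ball 0 (eta/2)) y + 1/14 * indicator (ball 0 eta) y"
  by (auto simp: h_def eta_def split: split_indicator)

lemma integrable_indicator_ball: "integrable lborel (indicat_real (ball (c::real^3) r))"
  using emeasure_bounded_finite[OF bounded_ball, of c r]
  by (intro integrable_real_indicator) auto

lemma h_integrable: "integrable lborel h"
  unfolding h_eq[abs_def]
  by (intro Bochner_Integration.integrable_diff integrable_mult_right integrable_indicator_ball)

text \<open>
  The volumes of the two balls have ratio \<open>1 : 8\<close>, and \<open>4/7 = 8/14\<close>.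
\<close>
lemma integral_h: "(\<integral>y. h y \<partial>lborel) = 0"
  unfolding h_eq
  by (subst Bochner_Integration.integral_diff)
     (simp_all add: integrable_indicator_ball measure_ball3 eta_def power3_eq_cube)

lemma integral_abs_h: "(\<integral>y. \<bar>h y\<bar> \<partial>lborel) = pi * eta ^ 3 / 6"
  unfolding abs_h_eq
  by (subst Bochner_Integration.integral_add)
     (simp_all add: integrable_indicator_ball measure_ball3 eta_def power3_eq_cube)

lemma F_integrable: "integrable lborel F" and integral_F: "(\<integral>y. F y \<partial>lborel) = 48 * pi"
proof -
  have *: "has_bochner_integral lborel F (48 * pi)"
    by (rule has_bochner_integral_nn_integral) (auto simp: nn_integral_F F_nonneg)
  show "integrable lborel F" "(\<integral>y. F y \<partial>lborel) = 48 * pi"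
    using * by (auto simp: has_bochner_integral_iff)
qed

lemma exp_norm_integrable: "integrable lborel (\<lambda>y::real^3. exp (- norm y))"
  and integral_exp_norm: "(\<integral>y. exp (- norm (y::real^3)) \<partial>lborel) = 8 * pi"
proof -
  have *: "has_bochner_integral lborel (\<lambda>y::real^3. exp (- norm y)) (8 * pi)"
    by (rule has_bochner_integral_nn_integral) (auto simp: nn_integral_exp_neg_norm)
  show "integrable lborel (\<lambda>y::real^3. exp (- norm y))" "(\<integral>y. exp (- norm (y::real^3)) \<partial>lborel) = 8 * pi"
    using * by (auto simp: has_bochner_integral_iff)
qed

section \<open>The perturbed functions\<close>

text \<open>
  The functions \<open>f\<close> and \<open>g\<close> are the cases \<open>\<sigma> = 1\<close> and \<open>\<sigma> = -1\<close>; the parameter lets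
  both halves of the comparison of their maximal functions be one statement.
\<close>
definition perturbed :: "real \<Rightarrow> real \<Rightarrow> real^3 \<Rightarrow> real" where
  "perturbed \<epsilon> \<sigma> y = F y + \<epsilon> * (exp (- norm y) + \<sigma> * h y)"

text \<open>
  On the core, \<open>exp (- norm y) \<ge> 1 - eta\<close> beats \<open>\<bar>h\<bar> \<le> 1/2\<close>.
\<close>
lemma exp_norm_gt_h:
  assumes "\<bar>\<sigma>\<bar> \<le> 1"
  shows "0 < exp (- norm y) + \<sigma> * h y"
proof (cases "norm y < eta")
  case True
  have "1 - norm y \<le> exp (- norm y)"
    using exp_ge_add_one_self[of "- norm y"] by simp
  moreover have "\<bar>\<sigma> * h y\<bar> \<le> 1 * (1/2)"
    unfolding abs_mult using assms h_bounds(1) by (intro mult_mono) auto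
  ultimately show ?thesis using True by (auto simp: eta_def)
next
  case False
  then show ?thesis by (simp add: h_bounds)
qed

lemma perturbed_pos: "\<bar>\<sigma>\<bar> \<le> 1 \<Longrightarrow> 0 < \<epsilon> \<Longrightarrow> 0 < perturbed \<epsilon> \<sigma> y"
  unfolding perturbed_def using F_nonneg[of y] exp_norm_gt_h[of \<sigma> y] by (simp add: add_nonneg_pos)

lemma F_le_perturbed: "\<bar>\<sigma>\<bar> \<le> 1 \<Longrightarrow> 0 < \<epsilon> \<Longrightarrow> F y \<le> perturbed \<epsilon> \<sigma> y"
  unfolding perturbed_def using exp_norm_gt_h[of \<sigma> y] by simp

lemma perturbed_measurable [measurable]: "perturbed \<epsilon> \<sigma> \<in> borel_measurable borel"
  unfolding perturbed_def[abs_def] by measurable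

lemma perturbed_integrable: "integrable lborel (perturbed \<epsilon> \<sigma>)"
  and integral_perturbed: "(\<integral>y. perturbed \<epsilon> \<sigma> y \<partial>lborel) = 48 * pi + 8 * pi * \<epsilon>"
  unfolding perturbed_def[abs_def]
  using F_integrable exp_norm_integrable h_integrable
  by (simp_all add: integral_F integral_exp_norm integral_h)

lemma u_le: "u s \<le> 1500"
  by (auto simp: u_def eta_def split: split_indicator)

lemma F_le: "F y \<le> 3000"
proof (cases "norm y > 1/2")
  case True
  have "u (norm y) \<le> 3000 * norm y" using True u_le[of "norm y"] by linarith
  then show ?thesis using True by (simp add: F_eq divide_le_eq)
next
  case False
  then have "u (norm y) = 0" by (auto simp: u_def eta_def split: split_indicator)
  then show ?thesis by (simp add: F_eq)
qed

lemma perturbed_bounded: "bounded (range (perturbed \<epsilon> \<sigma>))"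
proof (rule boundedI)
  fix t assume "t \<in> range (perturbed \<epsilon> \<sigma>)"
  then obtain y where t: "t = perturbed \<epsilon> \<sigma> y" by auto
  have "\<bar>exp (- norm y) + \<sigma> * h y\<bar> \<le> 1 + \<bar>\<sigma>\<bar> * (1/2)"
    using mult_left_mono[OF h_bounds(1)[of y], of "\<bar>\<sigma>\<bar>"]
    by (intro order_trans[OF abs_triangle_ineq] add_mono) (auto simp: abs_mult)
  then have "\<bar>\<epsilon> * (exp (- norm y) + \<sigma> * h y)\<bar> \<le> \<bar>\<epsilon>\<bar> * (1 + \<bar>\<sigma>\<bar> * (1/2))"
    unfolding abs_mult by (rule mult_left_mono) simp
  then show "norm t \<le> 3000 + \<bar>\<epsilon>\<bar> * (1 + \<bar>\<sigma>\<bar> * (1/2))"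
    unfolding t perturbed_def using F_le[of y] F_nonneg[of y] by simp
qed

lemma perturbed_radial: "radial (perturbed \<epsilon> \<sigma>)"
  unfolding radial_def
proof (intro allI impI)
  fix x y :: "real^3"
  assume xy: "norm x = norm y"
  then have "h x = h y" by (simp add: h_eq indicator_def)
  with xy show "perturbed \<epsilon> \<sigma> x = perturbed \<epsilon> \<sigma> y" by (simp add: perturbed_def F_eq)
qed

section \<open>Bounds for the profile on a shell\<close>

lemma eta_eq: "eta = 1/1000"
  by (simp add: eta_def)

lemma lens_profile_nonneg: "0 \<le> lens_profile \<rho> r s"
  by (simp add: lens_profile_def)

lemma lens_profile_ge:
  assumes "0 \<le> r" "r \<le> s + \<rho>"
  shows "r\<^sup>2 - (s - \<rho>)\<^sup>2 \<le> lens_profile \<rho> r s"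
proof -
  have "r\<^sup>2 \<le> (s + \<rho>)\<^sup>2" using assms by (intro power_mono) auto
  then have "r\<^sup>2 - (s - \<rho>)\<^sup>2 \<le> 4 * \<rho> * s"
    by (simp add: power2_eq_square algebra_simps)
  then show ?thesis by (simp add: lens_profile_def)
qed

text \<open>
  The hypothesis on \<open>r\<close> excludes that the sphere lies inside the ball, so the profile is at least
  \<open>r\<^sup>2 - (s - \<rho>)\<^sup>2\<close>; replacing \<open>s\<close> by the centre \<open>t\<close> of the shell costs at most
  \<open>2 eta M + eta\<^sup>2\<close>.
\<close>
lemma lens_profile_ge_shell:
  assumes s: "\<bar>s - t\<bar> < eta" and M: "\<bar>t - \<rho>\<bar> \<le> M" and r: "0 \<le> r" "r \<le> \<rho> + t - eta"
  shows "r\<^sup>2 - (t - \<rho>)\<^sup>2 - (2 * M + 1) * eta \<le> lens_profile \<rho> r s"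
proof -
  have "(s - \<rho>)\<^sup>2 = (t - \<rho>)\<^sup>2 + 2 * ((s - t) * (t - \<rho>)) + (s - t)\<^sup>2"
    by (simp add: power2_eq_square algebra_simps)
  moreover have "(s - t) * (t - \<rho>) \<le> eta * M"
  proof -
    have "(s - t) * (t - \<rho>) \<le> \<bar>s - t\<bar> * \<bar>t - \<rho>\<bar>" by (metis abs_ge_self abs_mult)
    also have "\<dots> \<le> eta * M" using s M by (intro mult_mono) auto
    finally show ?thesis .
  qed
  moreover have "(s - t)\<^sup>2 \<le> eta"
  proof -
    have "\<bar>s - t\<bar> * \<bar>s - t\<bar> \<le> eta * 1" using s by (intro mult_mono) (auto simp: eta_def)
    then show ?thesis by (simp add: power2_eq_square abs_mult[symmetric])
  qed
  ultimately have "r\<^sup>2 - (t - \<rho>)\<^sup>2 - (2 * M + 1) * eta \<le> r\<^sup>2 - (s - \<rho>)\<^sup>2"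
    by (simp add: algebra_simps)
  also have "\<dots> \<le> lens_profile \<rho> r s"
    using s r by (intro lens_profile_ge) auto
  finally show ?thesis .
qed

text \<open>
  The bound is crude, as \<open>r\<close>, \<open>s\<close> and \<open>\<rho>\<close> enter through separate extreme values in
  \<open>(r - \<rho> + s) (r + \<rho> - s)\<close>, but it suffices except for \<open>3 \<le> \<rho> \<le> 5.1\<close>.
\<close>
lemma lens_profile_le_shell:
  assumes s: "\<bar>s - t\<bar> < eta" and r: "\<bar>r - \<rho>\<bar> < eta" and t: "1 \<le> t"
    and a: "0 \<le> a" "(t + 2 * eta) * (2 * \<rho> - (t - 2 * eta)) \<le> a"
  shows "lens_profile \<rho> r s \<le> a"
proof -
  have f: "r\<^sup>2 - (s - \<rho>)\<^sup>2 = (r - \<rho> + s) * (r + \<rho> - s)"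
    by (simp add: power2_eq_square algebra_simps)
  have 1: "0 \<le> r - \<rho> + s" "r - \<rho> + s \<le> t + 2 * eta" "r + \<rho> - s \<le> 2 * \<rho> - (t - 2 * eta)"
    using s r t unfolding eta_eq by linarith+
  have "r\<^sup>2 - (s - \<rho>)\<^sup>2 \<le> a"
  proof (cases "0 \<le> r + \<rho> - s")
    case True
    then have "(r - \<rho> + s) * (r + \<rho> - s) \<le> (t + 2 * eta) * (2 * \<rho> - (t - 2 * eta))"
      using 1 by (intro mult_mono) auto
    with a f show ?thesis by simp
  next
    case False
    then have "(r - \<rho> + s) * (r + \<rho> - s) \<le> 0"
      using 1 by (intro mult_nonneg_nonpos) auto
    with a f show ?thesis by simp
  qed
  with a show ?thesis by (auto simp: lens_profile_def)
qed

section \<open>Comparison of averages\<close>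

definition ball_average :: "(real^3 \<Rightarrow> real) \<Rightarrow> real^3 \<Rightarrow> real \<Rightarrow> ennreal" where
  "ball_average f x r =
     (\<integral>\<^sup>+t\<in>ball x r. ennreal \<bar>f t\<bar> \<partial>lebesgue) / emeasure lebesgue (ball x r)"

lemma ball_average_perturbed:
  assumes "\<bar>\<sigma>\<bar> \<le> 1" "0 < \<epsilon>" "0 < r"
  shows "ball_average (perturbed \<epsilon> \<sigma>) x r
    = (\<integral>\<^sup>+y\<in>ball x r. ennreal (perturbed \<epsilon> \<sigma> y) \<partial>lborel) / ennreal (4/3 * pi * r ^ 3)"
  using assms perturbed_pos[OF assms(1,2)]
  by (simp add: ball_average_def nn_integral_completion emeasure_ball3 abs_of_pos)

text \<open>
  The perturbation is at most \<open>\<epsilon> (exp (- norm y) + \<bar>h y\<bar>)\<close>, of total mass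
  \<open>\<epsilon> (8 \<pi> + \<pi> eta\<^sup>3 / 6)\<close>.
\<close>
lemma nn_integral_perturbed_le:
  assumes "\<bar>\<sigma>\<bar> \<le> 1" "0 < \<epsilon>"
  shows "(\<integral>\<^sup>+y\<in>ball x r. ennreal (perturbed \<epsilon> \<sigma> y) \<partial>lborel)
    \<le> (\<integral>\<^sup>+y\<in>ball x r. ennreal (F y) \<partial>lborel) + ennreal (9 * pi * \<epsilon>)"
proof -
  have "(\<integral>\<^sup>+y\<in>ball x r. ennreal (perturbed \<epsilon> \<sigma> y) \<partial>lborel)
     \<le> (\<integral>\<^sup>+y. ennreal (F y) * indicator (ball x r) y + ennreal (\<epsilon> * (exp (- norm y) + \<bar>h y\<bar>)) \<partial>lborel)"
  proof (intro nn_integral_mono)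
    fix y :: "real^3"
    have "\<sigma> * h y \<le> \<bar>\<sigma>\<bar> * \<bar>h y\<bar>" by (metis abs_ge_self abs_mult)
    also have "\<dots> \<le> 1 * \<bar>h y\<bar>" using assms by (intro mult_right_mono) auto
    finally have "perturbed \<epsilon> \<sigma> y \<le> F y + \<epsilon> * (exp (- norm y) + \<bar>h y\<bar>)"
      unfolding perturbed_def using assms by simp
    then have "ennreal (perturbed \<epsilon> \<sigma> y) \<le> ennreal (F y) + ennreal (\<epsilon> * (exp (- norm y) + \<bar>h y\<bar>))"
      using assms F_nonneg[of y] by (simp add: ennreal_plus[symmetric] ennreal_leI del: ennreal_plus)
    then show "ennreal (perturbed \<epsilon> \<sigma> y) * indicator (ball x r) y
      \<le> ennreal (F y) * indicator (ball x r) y + ennreal (\<epsilon> * (exp (- norm y) + \<bar>h y\<bar>))"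
      by (auto simp: indicator_def)
  qed
  also have "\<dots> = (\<integral>\<^sup>+y\<in>ball x r. ennreal (F y) \<partial>lborel)
     + (\<integral>\<^sup>+y. ennreal (\<epsilon> * (exp (- norm (y::real^3)) + \<bar>h y\<bar>)) \<partial>lborel)"
    by (intro nn_integral_add borel_measurable_times_ennreal borel_measurable_indicator) simp_all
  also have "(\<integral>\<^sup>+y. ennreal (\<epsilon> * (exp (- norm (y::real^3)) + \<bar>h y\<bar>)) \<partial>lborel)
     = ennreal (\<integral>y. \<epsilon> * (exp (- norm (y::real^3)) + \<bar>h y\<bar>) \<partial>lborel)"
    using assms exp_norm_integrable h_integrable by (intro nn_integral_eq_integral) auto
  also have "(\<integral>y. \<epsilon> * (exp (- norm (y::real^3)) + \<bar>h y\<bar>) \<partial>lborel) = \<epsilon> * (8 * pi + pi * eta ^ 3 / 6)"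
    using exp_norm_integrable h_integrable
    by (simp add: integral_exp_norm integral_abs_h)
  also have "ennreal \<dots> \<le> ennreal (9 * pi * \<epsilon>)"
    using assms by (intro ennreal_leI) (simp add: eta_eq power3_eq_cube)
  finally show ?thesis by (simp add: add_left_mono)
qed

text \<open>
  A ball whose boundary avoids the core either contains the core, and then \<open>h\<close> integrates to zero over
  it, or misses the core, and then \<open>h\<close> vanishes on it.
\<close>
lemma nn_integral_perturbed_ball_eq:
  assumes \<sigma>: "\<bar>\<sigma>\<bar> \<le> 1" and \<tau>: "\<bar>\<tau>\<bar> \<le> 1" and \<epsilon>: "0 < \<epsilon>" and r: "0 < r" "eta \<le> \<bar>r - norm x\<bar>"
  shows "(\<integral>\<^sup>+y\<in>ball x r. ennreal (perturbed \<epsilon> \<sigma> y) \<partial>lborel) = (\<integral>\<^sup>+y\<in>ball x r. ennreal (perturbed \<epsilon> \<tau> y) \<partial>lborel)"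
proof -
  have h0: "(\<integral>y. indicat_real (ball x r) y * h y \<partial>lborel) = 0"
  proof (cases "norm x + eta \<le> r")
    case True
    have eq: "indicat_real (ball x r) y * h y = h y" for y
    proof (cases "norm y < eta")
      case True
      have "dist x y \<le> norm x + norm y" by (simp add: dist_norm norm_triangle_ineq4)
      with True \<open>norm x + eta \<le> r\<close> show ?thesis by simp
    qed (simp add: h_bounds)
    show ?thesis by (simp only: eq integral_h)
  next
    case False
    have eq: "indicat_real (ball x r) y * h y = 0" for y
    proof (cases "norm y < eta")
      case True
      have "norm x - norm y \<le> dist x y" by (simp add: dist_norm norm_triangle_ineq2)
      with True False r show ?thesis by simp
    qed (simp add: h_bounds)
    show ?thesis by (simp only: eq) simp
  qed
  have hi: "integrable lborel (\<lambda>y. indicat_real (ball x r) y * h y)"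
    using integrable_mult_indicator[OF _ h_integrable, of "ball x r"] by simp
  have Bi: "integrable lborel (\<lambda>y. indicat_real (ball x r) y * perturbed \<epsilon> \<upsilon> y)" for \<upsilon>
    using integrable_mult_indicator[OF _ perturbed_integrable, of "ball x r"] by simp
  have "(\<integral>\<^sup>+y\<in>ball x r. ennreal (perturbed \<epsilon> \<upsilon> y) \<partial>lborel)
     = ennreal (\<integral>y. indicat_real (ball x r) y * perturbed \<epsilon> 0 y \<partial>lborel)" if "\<bar>\<upsilon>\<bar> \<le> 1" for \<upsilon>
  proof -
    have "(\<integral>\<^sup>+y\<in>ball x r. ennreal (perturbed \<epsilon> \<upsilon> y) \<partial>lborel)
      = (\<integral>\<^sup>+y. ennreal (indicat_real (ball x r) y * perturbed \<epsilon> \<upsilon> y) \<partial>lborel)"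
      by (intro nn_integral_cong) (simp add: indicator_def)
    also have "\<dots> = ennreal (\<integral>y. indicat_real (ball x r) y * perturbed \<epsilon> \<upsilon> y \<partial>lborel)"
      using perturbed_pos[OF that \<epsilon>] by (intro nn_integral_eq_integral Bi) (simp add: less_imp_le)
    also have "(\<integral>y. indicat_real (ball x r) y * perturbed \<epsilon> \<upsilon> y \<partial>lborel)
      = (\<integral>y. indicat_real (ball x r) y * perturbed \<epsilon> 0 y + \<epsilon> * \<upsilon> * (indicat_real (ball x r) y * h y) \<partial>lborel)"
      by (simp add: perturbed_def algebra_simps)
    also have "\<dots> = (\<integral>y. indicat_real (ball x r) y * perturbed \<epsilon> 0 y \<partial>lborel)"
      using hi Bi by (subst Bochner_Integration.integral_add) (simp_all add: h0)
    finally show ?thesis .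
  qed
  from this[OF \<sigma>] this[OF \<tau>] show ?thesis by simp
qed

text \<open>
  With \<open>\<rho> = norm x\<close>, the numbers \<open>\<pi> U / \<rho>\<close> and \<open>\<pi> L / \<rho>\<close> bound the mass of \<open>F\<close> in
  the two balls. The summand \<open>\<rho> / 100000\<close> pays for the perturbation, whose mass is at most
  \<open>9 \<pi> \<epsilon> \<le> (\<pi> / \<rho>) (\<rho> / 100000)\<close>.
\<close>
lemma ball_average_perturbed_le_competitor:
  assumes "\<bar>\<sigma>\<bar> \<le> 1" "\<bar>\<tau>\<bar> \<le> 1" "0 < \<epsilon>" "\<epsilon> \<le> 1/10^6" "x \<noteq> 0" "0 < r" "0 < r'" "0 \<le> U"
    and upper: "(\<integral>\<^sup>+y\<in>ball x r. ennreal (F y) \<partial>lborel) \<le> ennreal (pi / norm x * U)"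
    and lower: "ennreal (pi / norm x * L) \<le> (\<integral>\<^sup>+y\<in>ball x r'. ennreal (F y) \<partial>lborel)"
    and UL: "(U + 1/100000 * norm x) * r' ^ 3 \<le> L * r ^ 3"
  shows "ball_average (perturbed \<epsilon> \<sigma>) x r \<le> ball_average (perturbed \<epsilon> \<tau>) x r'"
proof -
  define \<rho> where "\<rho> = norm x"
  have \<rho>: "0 < \<rho>" using assms by (simp add: \<rho>_def)
  have "ball_average (perturbed \<epsilon> \<sigma>) x r \<le> ennreal (pi / \<rho> * U + 9 * pi * \<epsilon>) / ennreal (4/3 * pi * r ^ 3)"
  proof -
    have "(\<integral>\<^sup>+y\<in>ball x r. ennreal (perturbed \<epsilon> \<sigma> y) \<partial>lborel) \<le> ennreal (pi / \<rho> * U) + ennreal (9 * pi * \<epsilon>)"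
      by (rule order_trans[OF nn_integral_perturbed_le]) (use assms in \<open>auto simp: \<rho>_def intro: add_mono\<close>)
    also have "\<dots> = ennreal (pi / \<rho> * U + 9 * pi * \<epsilon>)"
      using assms \<rho> by (intro ennreal_plus[symmetric]) auto
    finally show ?thesis
      unfolding ball_average_perturbed[OF assms(1,3,6)] by (rule divide_right_mono_ennreal)
  qed
  also have "\<dots> = ennreal ((pi / \<rho> * U + 9 * pi * \<epsilon>) / (4/3 * pi * r ^ 3))"
    using assms \<rho> by (intro divide_ennreal) auto
  also have "\<dots> \<le> ennreal ((pi / \<rho> * L) / (4/3 * pi * r' ^ 3))"
  proof (rule ennreal_leI)
    have "9 * \<epsilon> * \<rho> \<le> 1/100000 * \<rho>" using assms \<rho> by (intro mult_right_mono) auto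
    then have "(U + 9 * \<epsilon> * \<rho>) * r' ^ 3 \<le> (U + 1/100000 * \<rho>) * r' ^ 3"
      using assms by (intro mult_right_mono) auto
    also note UL[folded \<rho>_def]
    finally have "(U + 9 * \<epsilon> * \<rho>) / r ^ 3 \<le> L / r' ^ 3"
      using assms by (simp add: divide_simps mult.commute)
    then have "3 / (4 * \<rho>) * ((U + 9 * \<epsilon> * \<rho>) / r ^ 3) \<le> 3 / (4 * \<rho>) * (L / r' ^ 3)"
      using \<rho> by (intro mult_left_mono) auto
    moreover have "3 / (4 * \<rho>) * ((U + 9 * \<epsilon> * \<rho>) / r ^ 3) = (pi / \<rho> * U + 9 * pi * \<epsilon>) / (4/3 * pi * r ^ 3)"
      using \<rho> assms by (simp add: divide_simps) (simp add: algebra_simps)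
    moreover have "3 / (4 * \<rho>) * (L / r' ^ 3) = (pi / \<rho> * L) / (4/3 * pi * r' ^ 3)"
      using \<rho> assms by (simp add: divide_simps)
    ultimately show "(pi / \<rho> * U + 9 * pi * \<epsilon>) / (4/3 * pi * r ^ 3) \<le> (pi / \<rho> * L) / (4/3 * pi * r' ^ 3)"
      by simp
  qed
  also have "\<dots> = ennreal (pi / \<rho> * L) / ennreal (4/3 * pi * r' ^ 3)"
  proof (rule divide_ennreal[symmetric])
    have "0 \<le> (U + 1/100000 * norm x) * r' ^ 3" using assms by simp
    with UL have "0 \<le> L * r ^ 3" by linarith
    then have "0 \<le> L" using assms by (simp add: zero_le_mult_iff)
    then show "0 \<le> pi / \<rho> * L" using \<rho> by simp
  qed (use assms in auto)
  also have "\<dots> \<le> ball_average (perturbed \<epsilon> \<tau>) x r'"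
  proof -
    have "(\<integral>\<^sup>+y\<in>ball x r'. ennreal (F y) \<partial>lborel) \<le> (\<integral>\<^sup>+y\<in>ball x r'. ennreal (perturbed \<epsilon> \<tau> y) \<partial>lborel)"
      using F_le_perturbed[OF assms(2,3)] by (intro nn_integral_mono mult_right_mono ennreal_leI) auto
    with lower have "ennreal (pi / \<rho> * L) \<le> (\<integral>\<^sup>+y\<in>ball x r'. ennreal (perturbed \<epsilon> \<tau> y) \<partial>lborel)"
      unfolding \<rho>_def by (rule order_trans)
    then show ?thesis
      unfolding ball_average_perturbed[OF assms(2,3,7)] by (rule divide_right_mono_ennreal)
  qed
  finally show ?thesis .
qed

text \<open>
  A ball with \<open>r \<approx> \<rho> < 1/2\<close> lies inside the first shell, where only the perturbation, at most
  \<open>3/2 \<epsilon>\<close>, is present. The ball of radius \<open>3/2\<close> contains the first shell. This also covers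
  \<open>x = 0\<close>, where the profile formula is not available.
\<close>
lemma ball_average_perturbed_le_near_origin:
  assumes "\<bar>\<sigma>\<bar> \<le> 1" "\<bar>\<tau>\<bar> \<le> 1" "0 < \<epsilon>" "\<epsilon> \<le> 1/10^6" "0 < r"
    and r: "\<bar>r - norm x\<bar> < eta" and x: "norm x \<le> 499/1000"
  shows "ball_average (perturbed \<epsilon> \<sigma>) x r \<le> ball_average (perturbed \<epsilon> \<tau>) x (3/2)"
proof -
  have "ball_average (perturbed \<epsilon> \<sigma>) x r \<le> ennreal (3/2 * \<epsilon>)"
  proof -
    have "(\<integral>\<^sup>+y\<in>ball x r. ennreal (perturbed \<epsilon> \<sigma> y) \<partial>lborel) \<le> (\<integral>\<^sup>+y. ennreal (3/2 * \<epsilon>) * indicator (ball x r) y \<partial>lborel)"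
    proof (intro nn_integral_mono)
      fix y
      show "ennreal (perturbed \<epsilon> \<sigma> y) * indicator (ball x r) y \<le> ennreal (3/2 * \<epsilon>) * indicator (ball x r) y"
      proof (cases "y \<in> ball x r")
        case True
        have "norm y \<le> norm x + dist x y"
          by (metis dist_norm norm_minus_commute norm_triangle_sub)
        then have "norm y < 999/1000" using True r x unfolding eta_eq mem_ball by linarith
        then have "F y = 0" by (auto simp: F_eq u_def eta_def)
        moreover have "\<sigma> * h y \<le> 1 * (1/2)"
        proof -
          have "\<sigma> * h y \<le> \<bar>\<sigma>\<bar> * \<bar>h y\<bar>" by (metis abs_ge_self abs_mult)
          also have "\<dots> \<le> 1 * (1/2)" using assms h_bounds(1)[of y] by (intro mult_mono) auto
          finally show ?thesis .
        qed
        moreover have "exp (- norm y) \<le> 1" by simp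
        ultimately have "exp (- norm y) + \<sigma> * h y \<le> 3/2" by linarith
        then have "\<epsilon> * (exp (- norm y) + \<sigma> * h y) \<le> \<epsilon> * (3/2)"
          using assms by (intro mult_left_mono) auto
        then have "perturbed \<epsilon> \<sigma> y \<le> 3/2 * \<epsilon>"
          using \<open>F y = 0\<close> by (simp add: perturbed_def)
        then show ?thesis by (intro mult_right_mono ennreal_leI) auto
      qed simp
    qed
    also have "\<dots> = ennreal (3/2 * \<epsilon>) * ennreal (4/3 * pi * r ^ 3)"
      using assms by (subst nn_integral_cmult_indicator) (simp_all add: emeasure_ball3)
    also have "\<dots> = ennreal (3/2 * \<epsilon> * (4/3 * pi * r ^ 3))"
      using assms by (intro ennreal_mult[symmetric]) auto
    finally have "ball_average (perturbed \<epsilon> \<sigma>) x r \<le> ennreal (3/2 * \<epsilon> * (4/3 * pi * r ^ 3)) / ennreal (4/3 * pi * r ^ 3)"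
      unfolding ball_average_perturbed[OF assms(1,3,5)] by (rule divide_right_mono_ennreal)
    also have "\<dots> = ennreal (3/2 * \<epsilon>)"
      using assms by (subst divide_ennreal) auto
    finally show ?thesis .
  qed
  \<comment> \<open>The outer half of the first shell suffices; \<open>F > 400\<close> there.\<close>
  also have "\<dots> \<le> ennreal (400 * (4/3 * pi * (1 + eta) ^ 3 - 4/3 * pi) / (4/3 * pi * (3/2) ^ 3))"
    using assms by (intro ennreal_leI) (simp add: eta_def power3_eq_cube divide_simps)
  also have "\<dots> = ennreal (400 * (4/3 * pi * (1 + eta) ^ 3 - 4/3 * pi)) / ennreal (4/3 * pi * (3/2) ^ 3)"
    by (intro divide_ennreal[symmetric]) (simp_all add: eta_def power3_eq_cube)
  also have "\<dots> \<le> ball_average (perturbed \<epsilon> \<tau>) x (3/2)"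
  proof -
    have sub: "ball 0 1 \<subseteq> ball (0::real^3) (1 + eta)" by (auto simp: eta_def)
    have em: "emeasure lborel (ball (0::real^3) (1 + eta) - ball 0 1) = ennreal (4/3 * pi * (1 + eta) ^ 3 - 4/3 * pi)"
      using sub by (subst emeasure_Diff) (simp_all add: emeasure_ball3 ennreal_minus eta_def)
    have "ennreal (400 * (4/3 * pi * (1 + eta) ^ 3 - 4/3 * pi))
       = (\<integral>\<^sup>+y. ennreal 400 * indicator (ball (0::real^3) (1 + eta) - ball 0 1) y \<partial>lborel)"
      by (subst nn_integral_cmult_indicator, simp, subst em, rule ennreal_mult)
         (simp_all add: eta_eq power3_eq_cube)
    also have "\<dots> \<le> (\<integral>\<^sup>+y\<in>ball x (3/2). ennreal (perturbed \<epsilon> \<tau> y) \<partial>lborel)"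
    proof (intro nn_integral_mono)
      fix y :: "real^3"
      show "ennreal 400 * indicator (ball 0 (1 + eta) - ball 0 1) y \<le> ennreal (perturbed \<epsilon> \<tau> y) * indicator (ball x (3/2)) y"
      proof (cases "y \<in> ball 0 (1 + eta) - ball 0 1")
        case True
        then have y: "1 \<le> norm y" "norm y < 1 + eta" by auto
        have "u (norm y) \<ge> 500" using y by (auto simp: u_def eta_def)
        moreover have "y \<noteq> 0" using y by auto
        ultimately have "400 \<le> F y" using y by (simp add: F_eq eta_def le_divide_eq)
        then have "400 \<le> perturbed \<epsilon> \<tau> y" using F_le_perturbed[OF assms(2,3), of y] by simp
        moreover have "dist x y \<le> norm x + norm y" by (simp add: dist_norm norm_triangle_ineq4)
        then have "y \<in> ball x (3/2)" using y x by (simp add: eta_def)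
        ultimately show ?thesis using True by (simp add: ennreal_leI)
      qed simp
    qed
    finally show ?thesis
      by (subst ball_average_perturbed) (use assms in \<open>auto intro: divide_right_mono_ennreal\<close>)
  qed
  finally show ?thesis .
qed

section \<open>Polynomial inequalities for the competing radii\<close>

text \<open>
  Each inequality compares a bound for the weighted profile of \<open>ball x r\<close>, increased by the allowance
  \<open>\<rho> / 100000\<close> for the perturbation, with a lower bound for the weighted profile of the competing
  ball, cross-multiplied with the cubes of the radii; here \<open>r\<close> is replaced by \<open>\<rho> - eta\<close>, and by
  \<open>\<rho> + eta\<close> if the competing radius is \<open>\<rho> + 3/20\<close>. The certificates are Bernstein expansions: the
  difference of the two sides is a combination with nonnegative coefficients of products of powers of
  the distances from \<open>\<rho>\<close> to the end points of the interval. On the unbounded interval the Taylor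
  coefficients at its end point play this role.
\<close>

lemma outer_ineq_below_5_6:
  fixes \<rho> :: real
  assumes "499/1000 \<le> \<rho>" "\<rho> \<le> 5/6"
  shows "(1002/1000 * (2*\<rho> - 998/1000) + 3 * (1/250) + 13/1000 + 1/100000 * \<rho>) * (\<rho> + 1001/1000)^3
    \<le> (4 * (999/1000) * \<rho> + 3 * (8/3 * (2*\<rho> - 2/3)) + 0) * (\<rho> - 1/1000)^3"
proof -
  have "(4 * (999/1000) * \<rho> + 3 * (8/3 * (2*\<rho> - 2/3)) + 0) * (\<rho> - 1/1000)^3 - (1002/1000 * (2*\<rho> - 998/1000) + 3 * (1/250) + 13/1000 + 1/100000 * \<rho>) * (\<rho> + 1001/1000)^3
    = 4953684771618426/126506763510125 * (5/6 - \<rho>)^4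
      + 32811830299797903/253013527020250 * (\<rho> - 499/1000)^1 * (5/6 - \<rho>)^3
      + 229998612485202201/1012054108081000 * (\<rho> - 499/1000)^2 * (5/6 - \<rho>)^2
      + 30189001609163522681/101205410808100000 * (\<rho> - 499/1000)^3 * (5/6 - \<rho>)^1
      + 181718114024729501/1012054108081000 * (\<rho> - 499/1000)^4"
    by algebra
  also have "\<dots> \<ge> 0"
    using assms by (intro add_nonneg_nonneg mult_nonneg_nonneg zero_le_power) simp_all
  finally show ?thesis by simp
qed

lemma outer_ineq_5_6_to_87_100:
  fixes \<rho> :: real
  assumes "5/6 \<le> \<rho>" "\<rho> \<le> 87/100"
  shows "(1002/1000 * (2*\<rho> - 998/1000) + 3 * (5006/3000 * (2*\<rho> - 4994/3000)) + 13/1000 + 1/100000 * \<rho>) * (\<rho> + 1001/1000)^3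
    \<le> (4 * (999/1000) * \<rho> + 3 * (8/3 * (2*\<rho> - 2/3)) + 0) * (\<rho> - 1/1000)^3"
proof -
  have "(4 * (999/1000) * \<rho> + 3 * (8/3 * (2*\<rho> - 2/3)) + 0) * (\<rho> - 1/1000)^3 - (1002/1000 * (2*\<rho> - 998/1000) + 3 * (5006/3000 * (2*\<rho> - 4994/3000)) + 13/1000 + 1/100000 * \<rho>) * (\<rho> + 1001/1000)^3
    = 182711999109544529/146410000000 * (87/100 - \<rho>)^4
      + 5939837277578872863/1464100000000 * (\<rho> - 5/6)^1 * (87/100 - \<rho>)^3
      + 6796615993958287179/1464100000000 * (\<rho> - 5/6)^2 * (87/100 - \<rho>)^2
      + 3081978223945279029/1464100000000 * (\<rho> - 5/6)^3 * (87/100 - \<rho>)^1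
      + 398091199973778423/1464100000000 * (\<rho> - 5/6)^4"
    by algebra
  also have "\<dots> \<ge> 0"
    using assms by (intro add_nonneg_nonneg mult_nonneg_nonneg zero_le_power) simp_all
  finally show ?thesis by simp
qed

lemma near_shell_1_ineq:
  fixes \<rho> :: real
  assumes "87/100 \<le> \<rho>" "\<rho> \<le> 111/100"
  shows "(1002/1000 * (2*\<rho> - 998/1000) + 3 * (5006/3000 * (2*\<rho> - 4994/3000)) + 13/1000 + 1/100000 * \<rho>) * (22/100)^3
    \<le> ((22/100)^2 - (1 - \<rho>)^2 - 3/1000) * (\<rho> - 1/1000)^3"
proof -
  have "((22/100)^2 - (1 - \<rho>)^2 - 3/1000) * (\<rho> - 1/1000)^3 - (1002/1000 * (2*\<rho> - 998/1000) + 3 * (5006/3000 * (2*\<rho> - 4994/3000)) + 13/1000 + 1/100000 * \<rho>) * (22/100)^3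
    = 198960032227/23887872000 * (111/100 - \<rho>)^5
      + 1766934406127/23887872000 * (\<rho> - 87/100)^1 * (111/100 - \<rho>)^4
      + 2545194558863/11943936000 * (\<rho> - 87/100)^2 * (111/100 - \<rho>)^3
      + 3006272579663/11943936000 * (\<rho> - 87/100)^3 * (111/100 - \<rho>)^2
      + 2593256947247/23887872000 * (\<rho> - 87/100)^4 * (111/100 - \<rho>)^1
      + 79238659747/23887872000 * (\<rho> - 87/100)^5"
    by algebra
  also have "\<dots> \<ge> 0"
    using assms by (intro add_nonneg_nonneg mult_nonneg_nonneg zero_le_power) simp_all
  finally show ?thesis by simp
qed

lemma inner_ineq_111_to_130:
  fixes \<rho> :: real
  assumes "111/100 \<le> \<rho>" "\<rho> \<le> 13/10"
  shows "(1002/1000 * (2*\<rho> - 998/1000) + 3 * (5006/3000 * (2*\<rho> - 4994/3000)) + 13/1000 + 1/100000 * \<rho>) * (8/10)^3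
    \<le> (4 * (8/10)^2 - (1 - \<rho>)^2 - 3 * (5/3 - \<rho>)^2 - 20/1000) * (\<rho> - 1/1000)^3"
proof -
  have "(4 * (8/10)^2 - (1 - \<rho>)^2 - 3 * (5/3 - \<rho>)^2 - 20/1000) * (\<rho> - 1/1000)^3 - (1002/1000 * (2*\<rho> - 998/1000) + 3 * (5006/3000 * (2*\<rho> - 4994/3000)) + 13/1000 + 1/100000 * \<rho>) * (8/10)^3
    = 307500896541/619024750 * (13/10 - \<rho>)^5
      + 3437657883613/619024750 * (\<rho> - 111/100)^1 * (13/10 - \<rho>)^4
      + 11702068962813/619024750 * (\<rho> - 111/100)^2 * (13/10 - \<rho>)^3
      + 52522792145603/1857074250 * (\<rho> - 111/100)^3 * (13/10 - \<rho>)^2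
      + 3626676650503/185707425 * (\<rho> - 111/100)^4 * (13/10 - \<rho>)^1
      + 189045639793/37141485 * (\<rho> - 111/100)^5"
    by algebra
  also have "\<dots> \<ge> 0"
    using assms by (intro add_nonneg_nonneg mult_nonneg_nonneg zero_le_power) simp_all
  finally show ?thesis by simp
qed

lemma inner_ineq_130_to_155:
  fixes \<rho> :: real
  assumes "13/10 \<le> \<rho>" "\<rho> \<le> 31/20"
  shows "(1002/1000 * (2*\<rho> - 998/1000) + 3 * (5006/3000 * (2*\<rho> - 4994/3000)) + 13/1000 + 1/100000 * \<rho>) * (6/10)^3
    \<le> (4 * (6/10)^2 - (1 - \<rho>)^2 - 3 * (5/3 - \<rho>)^2 - 20/1000) * (\<rho> - 1/1000)^3"
proof -
  have "(4 * (6/10)^2 - (1 - \<rho>)^2 - 3 * (5/3 - \<rho>)^2 - 20/1000) * (\<rho> - 1/1000)^3 - (1002/1000 * (2*\<rho> - 998/1000) + 3 * (5006/3000 * (2*\<rho> - 4994/3000)) + 13/1000 + 1/100000 * \<rho>) * (6/10)^3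
    = 33514250787/48828125 * (31/20 - \<rho>)^5
      + 47520777933/9765625 * (\<rho> - 13/10)^1 * (31/20 - \<rho>)^4
      + 249787981821/19531250 * (\<rho> - 13/10)^2 * (31/20 - \<rho>)^3
      + 185449165799/11718750 * (\<rho> - 13/10)^3 * (31/20 - \<rho>)^2
      + 542534549771/58593750 * (\<rho> - 13/10)^4 * (31/20 - \<rho>)^1
      + 597553622927/292968750 * (\<rho> - 13/10)^5"
    by algebra
  also have "\<dots> \<ge> 0"
    using assms by (intro add_nonneg_nonneg mult_nonneg_nonneg zero_le_power) simp_all
  finally show ?thesis by simp
qed

lemma inner_ineq_155_to_200:
  fixes \<rho> :: real
  assumes "31/20 \<le> \<rho>" "\<rho> \<le> 2"
  shows "(1002/1000 * (2*\<rho> - 998/1000) + 3 * (5006/3000 * (2*\<rho> - 4994/3000)) + 13/1000 + 1/100000 * \<rho>) * (\<rho> - 1)^3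
    \<le> (4 * (\<rho> - 1)^2 - (1 - \<rho>)^2 - 3 * (5/3 - \<rho>)^2 - 20/1000) * (\<rho> - 1/1000)^3"
proof -
  have "(4 * (\<rho> - 1)^2 - (1 - \<rho>)^2 - 3 * (5/3 - \<rho>)^2 - 20/1000) * (\<rho> - 1/1000)^3 - (1002/1000 * (2*\<rho> - 998/1000) + 3 * (5006/3000 * (2*\<rho> - 4994/3000)) + 13/1000 + 1/100000 * \<rho>) * (\<rho> - 1)^3
    = 639498614803/16402500000 * (2 - \<rho>)^4
      + 1112816327173/4100625000 * (\<rho> - 31/20)^1 * (2 - \<rho>)^3
      + 104592710773/170859375 * (\<rho> - 31/20)^2 * (2 - \<rho>)^2
      + 279142836311/512578125 * (\<rho> - 31/20)^3 * (2 - \<rho>)^1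
      + 321494327201/2050312500 * (\<rho> - 31/20)^4"
    by algebra
  also have "\<dots> \<ge> 0"
    using assms by (intro add_nonneg_nonneg mult_nonneg_nonneg zero_le_power) simp_all
  finally show ?thesis by simp
qed

lemma inner_ineq_200_to_250:
  fixes \<rho> :: real
  assumes "2 \<le> \<rho>" "\<rho> \<le> 5/2"
  shows "(1002/1000 * (2*\<rho> - 998/1000) + 3 * (5006/3000 * (2*\<rho> - 4994/3000)) + 13/1000 + 1/100000 * \<rho>) * (5/3*\<rho> - 7/3)^3
    \<le> (4 * (5/3*\<rho> - 7/3)^2 - (1 - \<rho>)^2 - 3 * (5/3 - \<rho>)^2 - 20/1000) * (\<rho> - 1/1000)^3"
proof -
  have "(4 * (5/3*\<rho> - 7/3)^2 - (1 - \<rho>)^2 - 3 * (5/3 - \<rho>)^2 - 20/1000) * (\<rho> - 1/1000)^3 - (1002/1000 * (2*\<rho> - 998/1000) + 3 * (5006/3000 * (2*\<rho> - 4994/3000)) + 13/1000 + 1/100000 * \<rho>) * (5/3*\<rho> - 7/3)^3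
    = 321494327201/1562500000 * (5/2 - \<rho>)^5
      + 425036563521/312500000 * (\<rho> - 2)^1 * (5/2 - \<rho>)^4
      + 4778427980989/1406250000 * (\<rho> - 2)^2 * (5/2 - \<rho>)^3
      + 50540652603131/12656250000 * (\<rho> - 2)^3 * (5/2 - \<rho>)^2
      + 55613473172891/25312500000 * (\<rho> - 2)^4 * (5/2 - \<rho>)^1
      + 57520590399431/126562500000 * (\<rho> - 2)^5"
    by algebra
  also have "\<dots> \<ge> 0"
    using assms by (intro add_nonneg_nonneg mult_nonneg_nonneg zero_le_power) simp_all
  finally show ?thesis by simp
qed

lemma inner_ineq_250_to_300:
  fixes \<rho> :: real
  assumes "5/2 \<le> \<rho>" "\<rho> \<le> 3"
  shows "(1002/1000 * (2*\<rho> - 998/1000) + 3 * (5006/3000 * (2*\<rho> - 4994/3000)) + 13/1000 + 1/100000 * \<rho>) * (5/3*\<rho> - 7/3)^3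
    \<le> (4 * (5/3*\<rho> - 7/3)^2 - (1 - \<rho>)^2 - 3 * (5/3 - \<rho>)^2 - 20/1000) * (\<rho> - 1/1000)^3"
proof -
  have "(4 * (5/3*\<rho> - 7/3)^2 - (1 - \<rho>)^2 - 3 * (5/3 - \<rho>)^2 - 20/1000) * (\<rho> - 1/1000)^3 - (1002/1000 * (2*\<rho> - 998/1000) + 3 * (5006/3000 * (2*\<rho> - 4994/3000)) + 13/1000 + 1/100000 * \<rho>) * (5/3*\<rho> - 7/3)^3
    = 57520590399431/126562500000 * (3 - \<rho>)^5
      + 59427707625971/25312500000 * (\<rho> - 5/2)^1 * (3 - \<rho>)^4
      + 58169121509291/12656250000 * (\<rho> - 5/2)^2 * (3 - \<rho>)^3
      + 53041108910641/12656250000 * (\<rho> - 5/2)^3 * (3 - \<rho>)^2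
      + 44055114347521/25312500000 * (\<rho> - 5/2)^4 * (3 - \<rho>)^1
      + 32837749993681/126562500000 * (\<rho> - 5/2)^5"
    by algebra
  also have "\<dots> \<ge> 0"
    using assms by (intro add_nonneg_nonneg mult_nonneg_nonneg zero_le_power) simp_all
  finally show ?thesis by simp
qed

lemma all_shells_ineq_3_to_4:
  fixes \<rho> :: real
  assumes "3 \<le> \<rho>" "\<rho> \<le> 4"
  shows "(5 * (\<rho> + 1/1000)^2 - (\<rho> - 1001/1000)^2 - 3 * (\<rho> - 5003/3000)^2 - (5999/1000 - \<rho>)^2 + 1/100000 * \<rho>) * (\<rho> + 3/20)^3
    \<le> (5 * (\<rho> + 3/20)^2 - (1 - \<rho>)^2 - 3 * (5/3 - \<rho>)^2 - (6 - \<rho>)^2 - 1/20) * (\<rho> + 1/1000)^3"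
proof -
  have "(5 * (\<rho> + 3/20)^2 - (1 - \<rho>)^2 - 3 * (5/3 - \<rho>)^2 - (6 - \<rho>)^2 - 1/20) * (\<rho> + 1/1000)^3 - (5 * (\<rho> + 1/1000)^2 - (\<rho> - 1001/1000)^2 - 3 * (\<rho> - 5003/3000)^2 - (5999/1000 - \<rho>)^2 + 1/100000 * \<rho>) * (\<rho> + 3/20)^3
    = 433907948039/48000000000 * (4 - \<rho>)^4
      + 27871565159/1200000000 * (\<rho> - 3)^1 * (4 - \<rho>)^3
      + 145641777741/8000000000 * (\<rho> - 3)^2 * (4 - \<rho>)^2
      + 30090608123/3000000000 * (\<rho> - 3)^3 * (4 - \<rho>)^1
      + 359785241843/48000000000 * (\<rho> - 3)^4"
    by algebra
  also have "\<dots> \<ge> 0"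
    using assms by (intro add_nonneg_nonneg mult_nonneg_nonneg zero_le_power) simp_all
  finally show ?thesis by simp
qed

lemma all_shells_ineq_4_to_51_10:
  fixes \<rho> :: real
  assumes "4 \<le> \<rho>" "\<rho> \<le> 51/10"
  shows "(5 * (\<rho> + 1/1000)^2 - (\<rho> - 1001/1000)^2 - 3 * (\<rho> - 5003/3000)^2 - (5999/1000 - \<rho>)^2 + 1/100000 * \<rho>) * (\<rho> + 3/20)^3
    \<le> (5 * (\<rho> + 3/20)^2 - (1 - \<rho>)^2 - 3 * (5/3 - \<rho>)^2 - (6 - \<rho>)^2 - 1/20) * (\<rho> + 1/1000)^3"
proof -
  have "(5 * (\<rho> + 3/20)^2 - (1 - \<rho>)^2 - 3 * (5/3 - \<rho>)^2 - (6 - \<rho>)^2 - 1/20) * (\<rho> + 1/1000)^3 - (5 * (\<rho> + 1/1000)^2 - (\<rho> - 1001/1000)^2 - 3 * (\<rho> - 5003/3000)^2 - (5999/1000 - \<rho>)^2 + 1/100000 * \<rho>) * (\<rho> + 3/20)^3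
    = 359785241843/70276800000 * (51/10 - \<rho>)^4
      + 6231503321291/175692000000 * (\<rho> - 4)^1 * (51/10 - \<rho>)^3
      + 3017012573703/29282000000 * (\<rho> - 4)^2 * (51/10 - \<rho>)^2
      + 23195933841053/175692000000 * (\<rho> - 4)^3 * (51/10 - \<rho>)^1
      + 21373247573197/351384000000 * (\<rho> - 4)^4"
    by algebra
  also have "\<dots> \<ge> 0"
    using assms by (intro add_nonneg_nonneg mult_nonneg_nonneg zero_le_power) simp_all
  finally show ?thesis by simp
qed

lemma outer_ineq_above_51_10:
  fixes \<rho> :: real
  assumes "51/10 \<le> \<rho>"
  shows "(1002/1000 * (2*\<rho> - 998/1000) + 3 * (5006/3000 * (2*\<rho> - 4994/3000)) + 6002/1000 * (2*\<rho> - 5998/1000) + 1/100000 * \<rho>) * (\<rho> + 1001/1000)^3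
    \<le> (4 * (999/1000) * \<rho> + 3 * (8/3 * (2*\<rho> - 2/3)) + 7 * (2*\<rho> - 5)) * (\<rho> - 1/1000)^3"
proof -
  have "(4 * (999/1000) * \<rho> + 3 * (8/3 * (2*\<rho> - 2/3)) + 7 * (2*\<rho> - 5)) * (\<rho> - 1/1000)^3 - (1002/1000 * (2*\<rho> - 998/1000) + 3 * (5006/3000 * (2*\<rho> - 4994/3000)) + 6002/1000 * (2*\<rho> - 5998/1000) + 1/100000 * \<rho>) * (\<rho> + 1001/1000)^3
    = 113887752118369029/1000000000000000
      + 81254210345228799/100000000000000 * (\<rho> - 51/10)^1
      + 59222411934897/100000000000 * (\<rho> - 51/10)^2
      + 13627609797/100000000 * (\<rho> - 51/10)^3
      + 997599/100000 * (\<rho> - 51/10)^4"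
    by algebra
  also have "\<dots> \<ge> 0"
    using assms by (intro add_nonneg_nonneg mult_nonneg_nonneg zero_le_power) simp_all
  finally show ?thesis by simp
qed

section \<open>Existence of a competing radius\<close>

text \<open>
  Exactly what \<open>ball_average_perturbed_le_competitor\<close> asks of a competing radius \<open>r'\<close>, freed from
  \<open>\<epsilon>\<close>.
\<close>
definition has_competitor :: "real^3 \<Rightarrow> real \<Rightarrow> bool" where
  "has_competitor x r \<longleftrightarrow> (\<exists>r' U L. 0 < r' \<and> 0 \<le> U
     \<and> (\<integral>\<^sup>+y\<in>ball x r. ennreal (F y) \<partial>lborel) \<le> ennreal (pi / norm x * U)
     \<and> ennreal (pi / norm x * L) \<le> (\<integral>\<^sup>+y\<in>ball x r'. ennreal (F y) \<partial>lborel)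
     \<and> (U + 1/100000 * norm x) * r' ^ 3 \<le> L * r ^ 3)"

text \<open>
  Reduction to one variable: the crude upper bound on the mass in \<open>ball x r\<close> holds for every
  \<open>r\<close> within \<open>eta\<close> of \<open>\<rho>\<close>, and \<open>r\<^sup>3\<close> is bounded below by \<open>(\<rho> - 1/1000)\<^sup>3\<close>.
\<close>
lemma has_competitorI:
  assumes x: "1/1000 < norm x" and r: "\<bar>r - norm x\<bar> < eta"
    and abc: "0 \<le> a" "0 \<le> b" "0 \<le> c"
      "1002/1000 * (2 * norm x - 998/1000) \<le> a"
      "5006/3000 * (2 * norm x - 4994/3000) \<le> b"
      "6002/1000 * (2 * norm x - 5998/1000) \<le> c"
    and r': "0 < r'"
    and lower: "\<And>s. \<bar>s - 1\<bar> < eta \<Longrightarrow> a' \<le> lens_profile (norm x) r' s"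
      "\<And>s. \<bar>s - 5/3\<bar> < eta \<Longrightarrow> b' \<le> lens_profile (norm x) r' s"
      "\<And>s. \<bar>s - 6\<bar> < eta \<Longrightarrow> c' \<le> lens_profile (norm x) r' s"
    and le: "(a + 3 * b + c + 1/100000 * norm x) * r' ^ 3 \<le> (a' + 3 * b' + c') * (norm x - 1/1000) ^ 3"
  shows "has_competitor x r"
proof -
  have x0: "x \<noteq> 0" using x by auto
  have r0: "0 < r" using x r unfolding eta_eq by linarith
  have "(\<integral>\<^sup>+y\<in>ball x r. ennreal (F y) \<partial>lborel) \<le> ennreal (pi / norm x * (a + 3 * b + c))"
  proof (rule nn_integral_F_ball_le[OF x0 r0 abc(1-3)])
    show "lens_profile (norm x) r s \<le> a" if "\<bar>s - 1\<bar> < eta" for s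
      using abc by (intro lens_profile_le_shell[OF that r]) (simp_all add: eta_eq)
    show "lens_profile (norm x) r s \<le> b" if "\<bar>s - 5/3\<bar> < eta" for s
      using abc by (intro lens_profile_le_shell[OF that r]) (simp_all add: eta_eq)
    show "lens_profile (norm x) r s \<le> c" if "\<bar>s - 6\<bar> < eta" for s
      using abc by (intro lens_profile_le_shell[OF that r]) (simp_all add: eta_eq)
  qed
  moreover have "ennreal (pi / norm x * (a' + 3 * b' + c')) \<le> (\<integral>\<^sup>+y\<in>ball x r'. ennreal (F y) \<partial>lborel)"
    by (rule nn_integral_F_ball_ge[OF x0 r' lower])
  moreover have "(a + 3 * b + c + 1/100000 * norm x) * r' ^ 3 \<le> (a' + 3 * b' + c') * r ^ 3"
  proof -
    have "0 \<le> (a + 3 * b + c + 1/100000 * norm x) * r' ^ 3"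
      using abc r' by (intro mult_nonneg_nonneg add_nonneg_nonneg) auto
    with le have "0 \<le> (a' + 3 * b' + c') * (norm x - 1/1000) ^ 3" by linarith
    then have "0 \<le> a' + 3 * b' + c'" using x by (simp add: zero_le_mult_iff)
    moreover have "(norm x - 1/1000) ^ 3 \<le> r ^ 3"
      using x r unfolding eta_eq by (intro power_mono; linarith)
    ultimately show ?thesis using le by (meson mult_left_mono order_trans)
  qed
  ultimately show ?thesis
    unfolding has_competitor_def using r' abc by (intro exI[of _ r'] exI[of _ "a + 3 * b + c"] exI[of _ "a' + 3 * b' + c'"]) simp
qed

text \<open>
  The competitor \<open>r' = \<rho> + 1 + eta\<close> is the least radius whose ball contains the first shell. The
  alternative for \<open>c'\<close> is whether the third shell is taken into account, which pays
  once the ball reaches it.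
\<close>
lemma has_competitor_outer:
  assumes x: "499/1000 \<le> norm x" and r: "\<bar>r - norm x\<bar> < eta"
    and abc: "0 \<le> b" "0 \<le> c"
      "5006/3000 * (2 * norm x - 4994/3000) \<le> b"
      "6002/1000 * (2 * norm x - 5998/1000) \<le> c"
    and c': "c' = 0 \<or> c' = 7 * (2 * norm x - 5)"
    and le: "(1002/1000 * (2 * norm x - 998/1000) + 3 * b + c + 1/100000 * norm x) * (norm x + 1001/1000) ^ 3
      \<le> (4 * (999/1000) * norm x + 3 * (8/3 * (2 * norm x - 2/3)) + c') * (norm x - 1/1000) ^ 3"
  shows "has_competitor x r"
proof (rule has_competitorI[OF _ r _ abc(1,2) _ abc(3,4) _ _ _ _ le])
  let ?\<rho> = "norm x" let ?r = "norm x + 1001/1000"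
  show "4 * (999/1000) * ?\<rho> \<le> lens_profile ?\<rho> ?r s" if "\<bar>s - 1\<bar> < eta" for s
  proof -
    have s: "999/1000 \<le> s" "s \<le> 1001/1000" using that unfolding eta_eq by linarith+
    have "(s + ?\<rho>)\<^sup>2 \<le> ?r\<^sup>2" using s by (intro power_mono) auto
    then have "4 * ?\<rho> * s \<le> ?r\<^sup>2 - (s - ?\<rho>)\<^sup>2" by (simp add: power2_eq_square algebra_simps)
    moreover have "?\<rho> * (999/1000) \<le> ?\<rho> * s" using s by (intro mult_left_mono) auto
    ultimately show ?thesis by (simp add: lens_profile_def)
  qed
  have shell: "(t + 1) * (2 * ?\<rho> + 1 - t) \<le> lens_profile ?\<rho> ?r s"
    if "\<bar>s - t\<bar> < eta" "0 \<le> 2 * ?\<rho> + 1 - t" "5/3 \<le> t" for s t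
  proof -
    have s: "t - 1/1000 \<le> s" "s \<le> t + 1/1000" using that unfolding eta_eq by linarith+
    have "(t + 1) * (2 * ?\<rho> + 1 - t) \<le> (?r - ?\<rho> + s) * (?r + ?\<rho> - s)"
      using s that by (intro mult_mono) auto
    also have "\<dots> = ?r\<^sup>2 - (s - ?\<rho>)\<^sup>2" by (simp add: power2_eq_square algebra_simps)
    also have "\<dots> \<le> lens_profile ?\<rho> ?r s" using s that by (intro lens_profile_ge) auto
    finally show ?thesis .
  qed
  show "8/3 * (2 * ?\<rho> - 2/3) \<le> lens_profile ?\<rho> ?r s" if "\<bar>s - 5/3\<bar> < eta" for s
    using shell[OF that] x by simp
  show "c' \<le> lens_profile ?\<rho> ?r s" if "\<bar>s - 6\<bar> < eta" for s
  proof (cases "0 < c'")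
    case True
    then show ?thesis using shell[OF that] c' by auto
  next
    case False
    then show ?thesis using lens_profile_nonneg[of ?\<rho> ?r s] by linarith
  qed
qed (use x in \<open>auto simp: eta_eq\<close>)

text \<open>
  A competitor \<open>r' < \<rho>\<close>, credited with its mass in the first two shells only. The constant
  \<open>13/1000\<close> covers the part of the third shell that \<open>ball x r\<close> may touch as \<open>\<rho>\<close> approaches \<open>3\<close>.
\<close>
lemma has_competitor_inner:
  assumes x: "87/100 \<le> norm x" "norm x \<le> 3" and r: "\<bar>r - norm x\<bar> < eta"
    and r': "0 < r'" "r' \<le> norm x - 1/1000"
    and le: "(1002/1000 * (2 * norm x - 998/1000) + 3 * (5006/3000 * (2 * norm x - 4994/3000)) + 13/1000 + 1/100000 * norm x) * r' ^ 3
      \<le> (4 * r'^2 - (1 - norm x)^2 - 3 * (5/3 - norm x)^2 - 20/1000) * (norm x - 1/1000) ^ 3"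
  shows "has_competitor x r"
proof -
  let ?\<rho> = "norm x"
  have eq: "4 * r'^2 - (1 - ?\<rho>)^2 - 3 * (5/3 - ?\<rho>)^2 - 20/1000
     = r'^2 - (1 - ?\<rho>)\<^sup>2 - 5/1000 + 3 * (r'^2 - (5/3 - ?\<rho>)\<^sup>2 - 5/1000) + 0" by simp
  have shell: "r'^2 - (t - ?\<rho>)\<^sup>2 - 5/1000 \<le> lens_profile ?\<rho> r' s"
    if "\<bar>s - t\<bar> < eta" "1 \<le> t" "t \<le> 5/3" for s t
  proof -
    have "\<bar>t - ?\<rho>\<bar> \<le> 2" using that x by linarith
    from lens_profile_ge_shell[OF that(1) this, of r'] that r' show ?thesis
      by (simp add: eta_eq)
  qed
  show ?thesis
  proof (rule has_competitorI[OF _ r _ _ _ _ _ _ r'(1) _ _ _ le[unfolded eq]])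
    show "r'^2 - (1 - ?\<rho>)\<^sup>2 - 5/1000 \<le> lens_profile ?\<rho> r' s" if "\<bar>s - 1\<bar> < eta" for s
      using shell[OF that] by simp
    show "r'^2 - (5/3 - ?\<rho>)\<^sup>2 - 5/1000 \<le> lens_profile ?\<rho> r' s" if "\<bar>s - 5/3\<bar> < eta" for s
      using shell[OF that] by simp
    show "0 \<le> lens_profile ?\<rho> r' s" for s by (rule lens_profile_nonneg)
  qed (use x in auto)
qed

text \<open>
  Near the first shell, a small ball around \<open>x\<close> catches it almost flat and \<open>F\<close> is large there; the
  radius \<open>22/100\<close> is large enough to reach the shell from both ends of the interval.
\<close>
lemma has_competitor_near_shell_1:
  assumes x: "87/100 \<le> norm x" "norm x \<le> 111/100" and r: "\<bar>r - norm x\<bar> < eta"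
  shows "has_competitor x r"
proof -
  let ?\<rho> = "norm x"
  have le: "(1002/1000 * (2 * ?\<rho> - 998/1000) + 3 * (5006/3000 * (2 * ?\<rho> - 4994/3000)) + 13/1000 + 1/100000 * ?\<rho>) * (22/100) ^ 3
     \<le> ((22/100)^2 - (1 - ?\<rho>)\<^sup>2 - 3/1000 + 3 * 0 + 0) * (?\<rho> - 1/1000) ^ 3"
    using near_shell_1_ineq[OF x] by simp
  show ?thesis
  proof (rule has_competitorI[OF _ r _ _ _ _ _ _ _ _ _ _ le])
    show "(22/100)^2 - (1 - ?\<rho>)\<^sup>2 - 3/1000 \<le> lens_profile ?\<rho> (22/100) s" if "\<bar>s - 1\<bar> < eta" for s
      using lens_profile_ge_shell[OF that, of ?\<rho> 1 "22/100"] x by (simp add: eta_eq abs_le_iff)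
  qed (use x in \<open>auto simp: lens_profile_nonneg\<close>)
qed

text \<open>
  The tight range, where the bound of \<open>lens_profile_le_shell\<close> is too lossy and \<open>r\<close> is kept as
  a variable. With all three shells involved, the weighted profile is at most \<open>5 r\<^sup>2 - B\<close>, where \<open>B\<close>
  is the weighted sum of the squared distances from \<open>\<rho>\<close> to the shells. The quotient
  \<open>(5 r\<^sup>2 - B) / r\<^sup>3\<close> increases as long as \<open>5 r\<^sup>2 < 3 B\<close>; thus it suffices to compare the
  largest radius \<open>\<rho> + eta\<close> with the competitor \<open>\<rho> + 3/20\<close>.
\<close>
lemma has_competitor_all_shells:
  assumes x: "3 \<le> norm x" "norm x \<le> 51/10" and r: "\<bar>r - norm x\<bar> < eta"
  shows "has_competitor x r"
proof -
  define \<rho> where "\<rho> = norm x"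
  note x = x[folded \<rho>_def]
  have r1: "\<rho> - 1/1000 < r" "r < \<rho> + 1/1000" using r unfolding \<rho>_def eta_eq by linarith+
  have x0: "x \<noteq> 0" and r0: "0 < r" using x r1 by (auto simp: \<rho>_def)
  define B where "B = (\<rho> - 1001/1000)\<^sup>2 + 3 * (\<rho> - 5003/3000)\<^sup>2 + (5999/1000 - \<rho>)\<^sup>2"
  define R where "R = \<rho> + 1/1000"
  define L where "L = 5 * (\<rho> + 3/20)^2 - (1 - \<rho>)^2 - 3 * (5/3 - \<rho>)^2 - (6 - \<rho>)^2 - 1/20"
  have upper1: "lens_profile \<rho> r s \<le> r\<^sup>2 - \<beta>\<^sup>2" if "0 \<le> \<beta>" "\<beta> \<le> \<bar>s - \<rho>\<bar>" "\<beta> \<le> r" for \<beta> s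
  proof -
    have "\<beta>\<^sup>2 \<le> (s - \<rho>)\<^sup>2" using that by (metis abs_of_nonneg abs_le_square_iff)
    moreover have "\<beta>\<^sup>2 \<le> r\<^sup>2" using that by (intro power_mono)
    ultimately show ?thesis by (auto simp: lens_profile_def)
  qed
  have sq: "\<beta>\<^sup>2 \<le> r\<^sup>2" if "0 \<le> \<beta>" "\<beta> \<le> r" for \<beta> using that by (intro power_mono)
  have nn: "0 \<le> r\<^sup>2 - (\<rho> - 1001/1000)\<^sup>2" "0 \<le> r\<^sup>2 - (\<rho> - 5003/3000)\<^sup>2" "0 \<le> r\<^sup>2 - (5999/1000 - \<rho>)\<^sup>2"
    using sq[of "\<rho> - 1001/1000"] sq[of "\<rho> - 5003/3000"] sq[of "5999/1000 - \<rho>"] x r1 by auto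
  have "(\<integral>\<^sup>+y\<in>ball x r. ennreal (F y) \<partial>lborel)
    \<le> ennreal (pi / norm x * (r\<^sup>2 - (\<rho> - 1001/1000)\<^sup>2 + 3 * (r\<^sup>2 - (\<rho> - 5003/3000)\<^sup>2) + (r\<^sup>2 - (5999/1000 - \<rho>)\<^sup>2)))"
  proof (rule nn_integral_F_ball_le[OF x0 r0 nn], unfold \<rho>_def[symmetric])
    fix s
    show "lens_profile \<rho> r s \<le> r\<^sup>2 - (\<rho> - 1001/1000)\<^sup>2" if "\<bar>s - 1\<bar> < eta"
      by (rule upper1) (use that x r1 in \<open>unfold eta_eq, linarith+\<close>)
    show "lens_profile \<rho> r s \<le> r\<^sup>2 - (\<rho> - 5003/3000)\<^sup>2" if "\<bar>s - 5/3\<bar> < eta"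
      by (rule upper1) (use that x r1 in \<open>unfold eta_eq, linarith+\<close>)
    show "lens_profile \<rho> r s \<le> r\<^sup>2 - (5999/1000 - \<rho>)\<^sup>2" if "\<bar>s - 6\<bar> < eta"
      by (rule upper1) (use that x r1 in \<open>unfold eta_eq, linarith+\<close>)
  qed
  also have "r\<^sup>2 - (\<rho> - 1001/1000)\<^sup>2 + 3 * (r\<^sup>2 - (\<rho> - 5003/3000)\<^sup>2) + (r\<^sup>2 - (5999/1000 - \<rho>)\<^sup>2) = 5 * r\<^sup>2 - B"
    by (simp add: B_def)
  finally have upper: "(\<integral>\<^sup>+y\<in>ball x r. ennreal (F y) \<partial>lborel) \<le> ennreal (pi / norm x * (5 * r\<^sup>2 - B))" .
  have U0: "0 \<le> 5 * r\<^sup>2 - B" using nn by (simp add: B_def)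
  have lower1: "(\<rho> + 3/20)\<^sup>2 - (t - \<rho>)\<^sup>2 - 1/100 \<le> lens_profile \<rho> (\<rho> + 3/20) s"
    if "\<bar>s - t\<bar> < eta" "1 \<le> t" "t \<le> 6" for s t
  proof -
    have "\<bar>t - \<rho>\<bar> \<le> 44/10" using that x by linarith
    from lens_profile_ge_shell[OF that(1) this, of "\<rho> + 3/20"] that x show ?thesis
      by (simp add: eta_eq)
  qed
  have "ennreal (pi / norm x * ((\<rho> + 3/20)\<^sup>2 - (1 - \<rho>)\<^sup>2 - 1/100 + 3 * ((\<rho> + 3/20)\<^sup>2 - (5/3 - \<rho>)\<^sup>2 - 1/100)
      + ((\<rho> + 3/20)\<^sup>2 - (6 - \<rho>)\<^sup>2 - 1/100))) \<le> (\<integral>\<^sup>+y\<in>ball x (\<rho> + 3/20). ennreal (F y) \<partial>lborel)"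
    by (rule nn_integral_F_ball_ge[OF x0], unfold \<rho>_def[symmetric]) (use x in \<open>auto intro: lower1\<close>)
  also have "(\<rho> + 3/20)\<^sup>2 - (1 - \<rho>)\<^sup>2 - 1/100 + 3 * ((\<rho> + 3/20)\<^sup>2 - (5/3 - \<rho>)\<^sup>2 - 1/100)
      + ((\<rho> + 3/20)\<^sup>2 - (6 - \<rho>)\<^sup>2 - 1/100) = L"
    by (simp add: L_def)
  finally have lower: "ennreal (pi / norm x * L) \<le> (\<integral>\<^sup>+y\<in>ball x (\<rho> + 3/20). ennreal (F y) \<partial>lborel)" .
  \<comment> \<open>The allowance for the perturbation is absorbed into \<open>B\<close>, which barely affects the monotonicity.\<close>
  define B' where "B' = B - 1/100000 * \<rho>"
  have main: "(5 * R\<^sup>2 - B') * (\<rho> + 3/20) ^ 3 \<le> L * R ^ 3"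
  proof -
    have eq: "5 * R\<^sup>2 - B' = 5 * (\<rho> + 1/1000)^2 - (\<rho> - 1001/1000)^2 - 3 * (\<rho> - 5003/3000)^2 - (5999/1000 - \<rho>)^2 + 1/100000 * \<rho>"
      by (simp add: R_def B'_def B_def)
    show ?thesis
      unfolding eq unfolding L_def R_def
      using all_shells_ineq_3_to_4[of \<rho>] all_shells_ineq_4_to_51_10[of \<rho>] x by (cases "\<rho> \<le> 4") auto
  qed
  have mono: "(5 * r\<^sup>2 - B') * R ^ 3 \<le> (5 * R\<^sup>2 - B') * r ^ 3"
  proof -
    have rR: "0 < r" "r \<le> R" using r0 r1 by (auto simp: R_def)
    have BR: "5 * R\<^sup>2 \<le> 3 * B'"
    proof -
      have "3 * B' - 5 * R\<^sup>2 = 10 * (\<rho> - 36/10)\<^sup>2 + 2803/100000 * (51/10 - \<rho>) + 6257057/1000000"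
        unfolding B'_def B_def R_def by algebra
      also have "\<dots> \<ge> 0"
        using x by (intro add_nonneg_nonneg mult_nonneg_nonneg zero_le_power2) simp_all
      finally show ?thesis by simp
    qed
    have B0: "0 \<le> B'" using BR zero_le_power2[of R] by linarith
    have "5 * R\<^sup>2 * r\<^sup>2 \<le> 3 * B' * r\<^sup>2" using BR by (intro mult_right_mono) auto
    also have "\<dots> = B' * (r * r + r * r + r * r)" by (simp add: power2_eq_square)
    also have "\<dots> \<le> B' * (R * R + R * r + r * r)"
      using rR B0 by (intro mult_left_mono add_mono mult_mono) auto
    \<comment> \<open>The factor \<open>R - r\<close> divides the difference of the cross-multiplied quotients.\<close>
    finally have "0 \<le> (R - r) * (B' * (R * R + R * r + r * r) - 5 * R\<^sup>2 * r\<^sup>2)"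
      using rR by simp
    also have "\<dots> = (5 * R\<^sup>2 - B') * r ^ 3 - (5 * r\<^sup>2 - B') * R ^ 3" by algebra
    finally show ?thesis by simp
  qed
  have R0: "0 < R ^ 3" using x by (simp add: R_def)
  have le: "(5 * r\<^sup>2 - B + 1/100000 * norm x) * (\<rho> + 3/20) ^ 3 \<le> L * r ^ 3"
  proof -
    have "(5 * r\<^sup>2 - B') * (\<rho> + 3/20) ^ 3 * R ^ 3 = ((5 * r\<^sup>2 - B') * R ^ 3) * (\<rho> + 3/20) ^ 3" by simp
    also have "\<dots> \<le> ((5 * R\<^sup>2 - B') * r ^ 3) * (\<rho> + 3/20) ^ 3"
      using mono x by (intro mult_right_mono) auto
    also have "\<dots> = ((5 * R\<^sup>2 - B') * (\<rho> + 3/20) ^ 3) * r ^ 3" by simp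
    also have "\<dots> \<le> (L * R ^ 3) * r ^ 3" using main r0 by (intro mult_right_mono) auto
    also have "\<dots> = L * r ^ 3 * R ^ 3" by simp
    finally have "(5 * r\<^sup>2 - B') * (\<rho> + 3/20) ^ 3 \<le> L * r ^ 3"
      using R0 by (rule mult_right_le_imp_le)
    then show ?thesis by (simp add: B'_def \<rho>_def algebra_simps)
  qed
  show ?thesis
    unfolding has_competitor_def
    using upper lower le U0 x
    by (intro exI[of _ "\<rho> + 3/20"] exI[of _ "5 * r\<^sup>2 - B"] exI[of _ L]) (simp add: \<rho>_def eta_eq)
qed

lemma has_competitor:
  assumes x: "499/1000 \<le> norm x" and r: "\<bar>r - norm x\<bar> < eta"
  shows "has_competitor x r"
proof -
  consider "norm x \<le> 5/6" | "5/6 \<le> norm x" "norm x \<le> 87/100" | "87/100 \<le> norm x" "norm x \<le> 111/100"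
    | "111/100 \<le> norm x" "norm x \<le> 13/10" | "13/10 \<le> norm x" "norm x \<le> 31/20"
    | "31/20 \<le> norm x" "norm x \<le> 2" | "2 \<le> norm x" "norm x \<le> 5/2" | "5/2 \<le> norm x" "norm x \<le> 3"
    | "3 \<le> norm x" "norm x \<le> 51/10" | "51/10 \<le> norm x"
    by linarith
  then show ?thesis
  proof cases
    case 1
    then show ?thesis
      by (intro has_competitor_outer[OF x r, of "1/250" "13/1000" 0] outer_ineq_below_5_6 x) auto
  next
    case 2
    then show ?thesis
      by (intro has_competitor_outer[OF x r, of "5006/3000 * (2 * norm x - 4994/3000)" "13/1000" 0] outer_ineq_5_6_to_87_100) auto
  next
    case 3 then show ?thesis by (rule has_competitor_near_shell_1[OF _ _ r])
  next
    case 4 then show ?thesis using inner_ineq_111_to_130[of "norm x"] by (intro has_competitor_inner[OF _ _ r, of "8/10"]) auto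
  next
    case 5 then show ?thesis using inner_ineq_130_to_155[of "norm x"] by (intro has_competitor_inner[OF _ _ r, of "6/10"]) auto
  next
    case 6 then show ?thesis using inner_ineq_155_to_200[of "norm x"] by (intro has_competitor_inner[OF _ _ r, of "norm x - 1"]) auto
  next
    case 7 then show ?thesis using inner_ineq_200_to_250[of "norm x"] by (intro has_competitor_inner[OF _ _ r, of "5/3 * norm x - 7/3"]) auto
  next
    case 8 then show ?thesis using inner_ineq_250_to_300[of "norm x"] by (intro has_competitor_inner[OF _ _ r, of "5/3 * norm x - 7/3"]) auto
  next
    case 9 then show ?thesis by (rule has_competitor_all_shells[OF _ _ r])
  next
    case 10
    then show ?thesis
      by (intro has_competitor_outer[OF x r, of "5006/3000 * (2 * norm x - 4994/3000)" "6002/1000 * (2 * norm x - 5998/1000)" "7 * (2 * norm x - 5)"] outer_ineq_above_51_10) auto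
  qed
qed

section \<open>The maximal functions agree\<close>

text \<open>
  Every average that enters the left-hand supremum is bounded by one that enters the right-hand one.
\<close>
lemma Mc_perturbed_le:
  assumes \<sigma>: "\<bar>\<sigma>\<bar> \<le> 1" and \<tau>: "\<bar>\<tau>\<bar> \<le> 1" and \<epsilon>: "0 < \<epsilon>" "\<epsilon> \<le> 1/10^6"
  shows "Mc (perturbed \<epsilon> \<sigma>) x \<le> Mc (perturbed \<epsilon> \<tau>) x"
proof -
  have Mc_eq: "Mc f x = (SUP r\<in>{0<..}. ball_average f x r)" for f
    by (simp add: Mc_def ball_average_def)
  have "\<exists>r'\<in>{0<..}. ball_average (perturbed \<epsilon> \<sigma>) x r \<le> ball_average (perturbed \<epsilon> \<tau>) x r'" if r: "0 < r" for r
  proof (cases "eta \<le> \<bar>r - norm x\<bar>")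
    case True
    then have "ball_average (perturbed \<epsilon> \<sigma>) x r = ball_average (perturbed \<epsilon> \<tau>) x r"
      by (simp add: ball_average_perturbed[OF _ \<epsilon>(1) r] \<sigma> \<tau> nn_integral_perturbed_ball_eq[OF \<sigma> \<tau> \<epsilon>(1) r])
    with r show ?thesis by auto
  next
    case False
    then have near: "\<bar>r - norm x\<bar> < eta" by simp
    show ?thesis
    proof (cases "norm x \<le> 499/1000")
      case True
      then show ?thesis using ball_average_perturbed_le_near_origin[OF \<sigma> \<tau> \<epsilon> r near] by force
    next
      case False
      then have "has_competitor x r" by (intro has_competitor[OF _ near]) simp
      then obtain r' U L where "0 < r'" "0 \<le> U"
        "(\<integral>\<^sup>+y\<in>ball x r. ennreal (F y) \<partial>lborel) \<le> ennreal (pi / norm x * U)"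
        "ennreal (pi / norm x * L) \<le> (\<integral>\<^sup>+y\<in>ball x r'. ennreal (F y) \<partial>lborel)"
        "(U + 1/100000 * norm x) * r' ^ 3 \<le> L * r ^ 3"
        unfolding has_competitor_def by blast
      moreover have "x \<noteq> 0" using False by auto
      ultimately show ?thesis
        using ball_average_perturbed_le_competitor[OF \<sigma> \<tau> \<epsilon> _ r] by blast
    qed
  qed
  then show ?thesis
    unfolding Mc_eq by (intro SUP_mono) auto
qed

theorem theorem4:
  fixes \<epsilon> :: real and f g :: "real^3 \<Rightarrow> real"
  assumes "0 < \<epsilon>" and "\<epsilon> \<le> 1 / 10 ^ 6"
    and "f = (\<lambda>y. F y + \<epsilon> * (exp (- norm y) + h y))"
    and "g = (\<lambda>y. F y + \<epsilon> * (exp (- norm y) - h y))"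
  shows "bounded (range f) \<and> bounded (range g)
    \<and> radial f \<and> radial g
    \<and> (\<forall>y. 0 < f y) \<and> (\<forall>y. 0 < g y)
    \<and> integrable lebesgue f \<and> integrable lebesgue g
    \<and> (\<forall>x. Mc f x = Mc g x)
    \<and> L1_norm (\<lambda>y. f y - g y) = \<epsilon> * pi * eta ^ 3 / 3
    \<and> \<epsilon> * pi * eta ^ 3 / 3 > 0
    \<and> L1_norm f = 48 * pi + 8 * pi * \<epsilon>
    \<and> L1_norm g = 48 * pi + 8 * pi * \<epsilon>"
proof -
  have f: "f = perturbed \<epsilon> 1" and g: "g = perturbed \<epsilon> (-1)"
    by (auto simp: assms(3,4) perturbed_def)
  have pos: "0 < f y" "0 < g y" for y
    unfolding f g using assms by (auto intro: perturbed_pos)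
  have "Mc f x = Mc g x" for x
    unfolding f g using assms by (intro antisym Mc_perturbed_le) auto
  moreover have "L1_norm (\<lambda>y. f y - g y) = \<epsilon> * pi * eta ^ 3 / 3"
  proof -
    have "\<bar>f y - g y\<bar> = 2 * \<epsilon> * \<bar>h y\<bar>" for y
    proof -
      have "f y - g y = 2 * \<epsilon> * h y" by (simp add: assms(3,4) algebra_simps)
      then show ?thesis using assms by (simp add: abs_mult)
    qed
    then show ?thesis
      by (simp add: L1_norm_def integral_completion integral_abs_h)
  qed
  moreover have "L1_norm f = 48 * pi + 8 * pi * \<epsilon>" "L1_norm g = 48 * pi + 8 * pi * \<epsilon>"
    using pos by (simp_all add: L1_norm_def abs_of_pos f g integral_completion integral_perturbed)
  moreover have "integrable lebesgue f" "integrable lebesgue g"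
    unfolding f g by (simp_all add: integrable_completion perturbed_integrable)
  moreover have "\<epsilon> * pi * eta ^ 3 / 3 > 0"
    using assms by (simp add: eta_eq)
  ultimately show ?thesis
    using pos perturbed_bounded perturbed_radial unfolding f g by blast
qed

end
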